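(* Let $\varphi\colon (Q,\mathfrak n)\to (R,\mathfrak m)$ be a surjective local (or graded-local) homomorphism of local (respectively, graded-local) rings with common residue field $k$, and let $M$ be a finitely generated (respectively, finitely generated graded) $R$-module. Suppose $\operatorname{Burch}(\varphi)\ge 2$. Then for every $q\ge 4$ $$k\text{-}\operatorname{rank}(\operatorname{syz}_{q+1}^R M)\ \ge\ 1.$$
   Context: Local rings are commutative Noetherian. A graded-local ring is a commutative Noetherian $\mathbb N$-graded (or $\mathbb N^l$-multigraded) ring whose degree $0$ piece is a field $k$; its maximal ideal is the homogeneous maximal ideal and $k$ is its residue field. In the graded setting $Q$ and $R$ have the same degree $0$ field $k$. The ring $Q$ is not assumed regular. Syzygies: $\operatorname{syz}_i^R(M)$ is the $i$-th syzygy of $M$ in its minimal (graded, in the graded setting) $R$-free resolution $(F,\partial)$, i.e. $\operatorname{syz}_0^R(M)=M$, $\operatorname{syz}_1^R(M)=\ker(F_0\to M)$, and $\operatorname{syz}_{q+1}^R(M)=\ker(\partial_q\colon F_q\to F_{q-1})$ for $q\ge 1$. $k$-rank: for a finitely generated $R$-module $N$, $k\text{-}\operatorname{rank}(N)$ is the maximal $n$ such that $k^n$ is isomorphic to a direct summand of $N$. Burch index: with $I=\ker\varphi$, the Burch ideal is $\operatorname{BI}(\varphi)=I\mathfrak n:_Q(I:_Q\mathfrak n)$, and $\operatorname{Burch}(\varphi)=\dim_k \mathfrak n/\operatorname{BI}(\varphi)$. When $\operatorname{depth}(R)\ne 0$ or $I=0$ one has $(I:\mathfrak n)=I$, so $\operatorname{BI}(\varphi)=\mathfrak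 n$ and $\operatorname{Burch}(\varphi)=0$.
   Formalization: M is additionally assumed not to be free: if M is free (or zero), syz_{q+1} M = 0 has k-rank 0 for q ≥ 4, while Burch(φ) ≥ 2 can hold, e.g. Q = k[[x,y]] with ker φ = n², so the claim fails exactly there. *)

theory Defs
  imports
    "HOL-Algebra.Ring_Divisibility"
    "HOL-Algebra.Ideal_Product"
    "HOL-Algebra.QuotRing"
    "Jordan_Normal_Form.Missing_VectorSpace"
    "HOL-Library.Extended_Nat"
begin

section \<open>Local rings and the Burch index\<close>

definition local_ring :: "('a, 'b) ring_scheme \<Rightarrow> 'a set \<Rightarrow> bool" where
  "local_ring R m \<longleftrightarrow> cring R \<and> noetherian_ring R \<and> maximalideal m R \<and>
     (\<forall>J. maximalideal J R \<longrightarrow> J = m)"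

definition surjective_local_hom ::
    "('a, 'b) ring_scheme \<Rightarrow> 'a set \<Rightarrow> ('c, 'd) ring_scheme \<Rightarrow> 'c set \<Rightarrow> ('a \<Rightarrow> 'c) \<Rightarrow> bool" where
  "surjective_local_hom Q n R m \<phi> \<longleftrightarrow>
     \<phi> \<in> ring_hom Q R \<and> \<phi> ` carrier Q = carrier R \<and> \<phi> ` n \<subseteq> m"

definition colon_ideal :: "('a, 'b) ring_scheme \<Rightarrow> 'a set \<Rightarrow> 'a set \<Rightarrow> 'a set" where
  "colon_ideal Q I J = {x \<in> carrier Q. \<forall>y\<in>J. x \<otimes>\<^bsub>Q\<^esub> y \<in> I}"

definition burch_ideal ::
    "('a, 'b) ring_scheme \<Rightarrow> 'a set \<Rightarrow> ('c, 'd) ring_scheme \<Rightarrow> ('a \<Rightarrow> 'c) \<Rightarrow> 'a set" where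
  "burch_ideal Q n R \<phi> = (let I = a_kernel Q R \<phi>
     in colon_ideal Q (ideal_prod Q I n) (colon_ideal Q I n))"

text \<open>The module \<open>n/B\<close> over \<open>Q/n\<close>, for ideals with \<open>n \<cdot> n \<subseteq> B\<close>. The scalar multiplication sends
  \<open>(a + n, x + B)\<close> to \<open>a x + B\<close>; the fields \<open>mult\<close> and \<open>one\<close> of the module record carry no meaning
  for a module. For \<open>I = 0\<close> and \<open>(0 : n) = 0\<close> the formula for the Burch ideal yields \<open>B = Q\<close> rather
  than \<open>B = n\<close>; as only cosets of elements of \<open>n\<close> are taken, the quotient is the zero space and
  the Burch index is \<open>0\<close> also there.\<close>

definition ideal_quotient_space ::
    "('a, 'b) ring_scheme \<Rightarrow> 'a set \<Rightarrow> 'a set \<Rightarrow> ('a set, 'a set) module" where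
  "ideal_quotient_space Q n B =
     \<lparr>carrier = (\<lambda>x. B +>\<^bsub>Q\<^esub> x) ` n, mult = (\<lambda>X Y. B), one = B, zero = B,
      add = set_add Q, smult = rcoset_mult Q B\<rparr>"

definition burch_index ::
    "('a, 'b) ring_scheme \<Rightarrow> 'a set \<Rightarrow> ('c, 'd) ring_scheme \<Rightarrow> ('a \<Rightarrow> 'c) \<Rightarrow> nat" where
  "burch_index Q n R \<phi> =
     vectorspace.dim (Q Quot n) (ideal_quotient_space Q n (burch_ideal Q n R \<phi>))"


section \<open>Modules, \<open>k\<close>-rank, minimal free resolutions\<close>

definition fin_gen_module :: "('a, 'b) ring_scheme \<Rightarrow> ('a, 'c, 'd) module_scheme \<Rightarrow> bool" where
  "fin_gen_module R M \<longleftrightarrow> module R M \<and>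
     (\<exists>S. finite S \<and> S \<subseteq> carrier M \<and> module.span R M S = carrier M)"

definition module_basis ::
    "('a, 'b) ring_scheme \<Rightarrow> ('a, 'c, 'd) module_scheme \<Rightarrow> 'c set \<Rightarrow> bool" where
  "module_basis R M S \<longleftrightarrow>
     S \<subseteq> carrier M \<and> \<not> module.lin_dep R M S \<and> module.span R M S = carrier M"

definition free_module :: "('a, 'b) ring_scheme \<Rightarrow> ('a, 'c, 'd) module_scheme \<Rightarrow> bool" where
  "free_module R M \<longleftrightarrow> module R M \<and> (\<exists>S. module_basis R M S)"

definition module_iso ::
    "('a, 'b) ring_scheme \<Rightarrow> ('a, 'c, 'd) module_scheme \<Rightarrow> ('a, 'e, 'f) module_scheme \<Rightarrow> bool" where
  "module_iso R M N \<longleftrightarrow> (\<exists>f \<in> module_hom R M N. bij_betw f (carrier M) (carrier N))"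

definition restrict_scalars :: "('a \<Rightarrow> 'b) \<Rightarrow> ('b, 'c, 'd) module_scheme \<Rightarrow> ('a, 'c) module" where
  "restrict_scalars f M =
     \<lparr>carrier = carrier M, mult = mult M, one = one M, zero = zero M, add = add M,
      smult = (\<lambda>a x. f a \<odot>\<^bsub>M\<^esub> x)\<rparr>"

text \<open>\<open>k\<^sup>n\<close> for \<open>k = R/m\<close>, as an \<open>R\<close>-module.\<close>

definition residue_power ::
    "('a, 'b) ring_scheme \<Rightarrow> 'a set \<Rightarrow> nat \<Rightarrow> ('a, nat \<Rightarrow> 'a set) module" where
  "residue_power R m n =
     restrict_scalars (\<lambda>r. m +>\<^bsub>R\<^esub> r) (ring.func_space (R Quot m) {..<n})"

definition direct_summand ::
    "('a, 'b) ring_scheme \<Rightarrow> 'c set \<Rightarrow> ('a, 'c, 'd) module_scheme \<Rightarrow> bool" where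
  "direct_summand R A N \<longleftrightarrow> LinearCombinations.submodule R A N \<and>
     (\<exists>C. LinearCombinations.submodule R C N \<and> A \<inter> C = {\<zero>\<^bsub>N\<^esub>} \<and>
          module.submodule_sum N A C = carrier N)"

text \<open>For a finitely generated module over a Noetherian ring the supremum is a maximum.\<close>

definition k_rank :: "('a, 'b) ring_scheme \<Rightarrow> 'a set \<Rightarrow> ('a, 'c, 'd) module_scheme \<Rightarrow> enat" where
  "k_rank R m N = Sup {enat n | n.
     \<exists>A. direct_summand R A N \<and> module_iso R (residue_power R m n) (N\<lparr>carrier := A\<rparr>)}"

definition ideal_smult ::
    "('a, 'b) ring_scheme \<Rightarrow> 'a set \<Rightarrow> ('a, 'c, 'd) module_scheme \<Rightarrow> 'c set" where
  "ideal_smult R I M = module.span R M {a \<odot>\<^bsub>M\<^esub> x | a x. a \<in> I \<and> x \<in> carrier M}"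

text \<open>The differential \<open>F\<^sub>i\<^sub>+\<^sub>1 \<rightarrow> F\<^sub>i\<close> is \<open>\<delta> (Suc i)\<close> and the augmentation \<open>F\<^sub>0 \<rightarrow> M\<close> is \<open>\<epsilon>\<close>;
  \<open>\<delta> 0\<close> is not used.\<close>

definition minimal_free_resolution ::
    "('a, 'b) ring_scheme \<Rightarrow> 'a set \<Rightarrow> ('a, 'c, 'd) module_scheme \<Rightarrow>
     (nat \<Rightarrow> ('a, 'e) module) \<Rightarrow> (nat \<Rightarrow> 'e \<Rightarrow> 'e) \<Rightarrow> ('e \<Rightarrow> 'c) \<Rightarrow> bool" where
  "minimal_free_resolution R m M F \<delta> \<epsilon> \<longleftrightarrow>
     (\<forall>i. module R (F i) \<and> (\<exists>S. finite S \<and> module_basis R (F i) S)) \<and>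
     \<epsilon> \<in> module_hom R (F 0) M \<and>
     (\<forall>i. \<delta> (Suc i) \<in> module_hom R (F (Suc i)) (F i)) \<and>
     \<epsilon> ` carrier (F 0) = carrier M \<and>
     \<delta> 1 ` carrier (F 1) = a_kernel (F 0) M \<epsilon> \<and>
     (\<forall>i. \<delta> (Suc (Suc i)) ` carrier (F (Suc (Suc i))) = a_kernel (F (Suc i)) (F i) (\<delta> (Suc i))) \<and>
     (\<forall>i. \<delta> (Suc i) ` carrier (F (Suc i)) \<subseteq> ideal_smult R m (F i))"

text \<open>\<open>syz_Suc F \<delta> M \<epsilon> q\<close> is the \<open>(q + 1)\<close>-st syzygy of \<open>M\<close> in the resolution \<open>(F, \<delta>)\<close>, that is,
  the kernel of the map out of \<open>F\<^sub>q\<close>. (The zeroth syzygy, \<open>M\<close> itself, lives in a different type.)\<close>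

definition syz_Suc ::
    "(nat \<Rightarrow> ('a, 'e) module) \<Rightarrow> (nat \<Rightarrow> 'e \<Rightarrow> 'e) \<Rightarrow> ('a, 'c, 'd) module_scheme \<Rightarrow> ('e \<Rightarrow> 'c) \<Rightarrow>
     nat \<Rightarrow> ('a, 'e) module" where
  "syz_Suc F \<delta> M \<epsilon> q = (F q)\<lparr>carrier :=
     (case q of 0 \<Rightarrow> a_kernel (F 0) M \<epsilon> | Suc p \<Rightarrow> a_kernel (F (Suc p)) (F p) (\<delta> (Suc p)))\<rparr>"


section \<open>The graded setting\<close>

text \<open>A ring is graded by \<open>\<nat>\<^sup>l\<close>, rendered as \<open>'l \<Rightarrow> nat\<close> for a finite type \<open>'l\<close>, and a module by
  \<open>\<int>\<^sup>l\<close>, rendered as \<open>'l \<Rightarrow> int\<close>.\<close>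

definition direct_sum_decomposition :: "('a, 'b) ring_scheme \<Rightarrow> ('d \<Rightarrow> 'a set) \<Rightarrow> bool" where
  "direct_sum_decomposition A G \<longleftrightarrow>
     (\<forall>d. additive_subgroup (G d) A) \<and>
     (\<forall>x \<in> carrier A. \<exists>!f. (\<forall>d. f d \<in> G d) \<and> finite {d. f d \<noteq> \<zero>\<^bsub>A\<^esub>} \<and>
        x = finsum A f {d. f d \<noteq> \<zero>\<^bsub>A\<^esub>})"

definition graded_ring :: "('a, 'b) ring_scheme \<Rightarrow> (('l::finite \<Rightarrow> nat) \<Rightarrow> 'a set) \<Rightarrow> bool" where
  "graded_ring R G \<longleftrightarrow> cring R \<and> direct_sum_decomposition R G \<and> \<one>\<^bsub>R\<^esub> \<in> G (\<lambda>_. 0) \<and>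
     (\<forall>d e. \<forall>x \<in> G d. \<forall>y \<in> G e. x \<otimes>\<^bsub>R\<^esub> y \<in> G (\<lambda>i. d i + e i))"

definition graded_local_ring ::
    "('a, 'b) ring_scheme \<Rightarrow> (('l::finite \<Rightarrow> nat) \<Rightarrow> 'a set) \<Rightarrow> 'a set \<Rightarrow> bool" where
  "graded_local_ring R G m \<longleftrightarrow> graded_ring R G \<and> noetherian_ring R \<and>
     field (R\<lparr>carrier := G (\<lambda>_. 0)\<rparr>) \<and> m = Idl\<^bsub>R\<^esub> (\<Union>d \<in> {d. d \<noteq> (\<lambda>_. 0)}. G d)"

definition graded_module ::
    "('a, 'b) ring_scheme \<Rightarrow> (('l::finite \<Rightarrow> nat) \<Rightarrow> 'a set) \<Rightarrow>
     ('a, 'c, 'd) module_scheme \<Rightarrow> (('l \<Rightarrow> int) \<Rightarrow> 'c set) \<Rightarrow> bool" where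
  "graded_module R G M H \<longleftrightarrow> module R M \<and> direct_sum_decomposition M H \<and>
     (\<forall>d e. \<forall>a \<in> G d. \<forall>x \<in> H e. a \<odot>\<^bsub>M\<^esub> x \<in> H (\<lambda>i. int (d i) + e i))"

definition minimal_graded_free_resolution ::
    "('a, 'b) ring_scheme \<Rightarrow> (('l::finite \<Rightarrow> nat) \<Rightarrow> 'a set) \<Rightarrow> 'a set \<Rightarrow>
     ('a, 'c, 'd) module_scheme \<Rightarrow> (('l \<Rightarrow> int) \<Rightarrow> 'c set) \<Rightarrow>
     (nat \<Rightarrow> ('a, 'e) module) \<Rightarrow> (nat \<Rightarrow> ('l \<Rightarrow> int) \<Rightarrow> 'e set) \<Rightarrow>
     (nat \<Rightarrow> 'e \<Rightarrow> 'e) \<Rightarrow> ('e \<Rightarrow> 'c) \<Rightarrow> bool" where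
  "minimal_graded_free_resolution R G m M H F FH \<delta> \<epsilon> \<longleftrightarrow>
     minimal_free_resolution R m M F \<delta> \<epsilon> \<and>
     (\<forall>i. graded_module R G (F i) (FH i) \<and>
          (\<exists>S. finite S \<and> S \<subseteq> (\<Union>d. FH i d) \<and> module_basis R (F i) S)) \<and>
     (\<forall>d. \<epsilon> ` FH 0 d \<subseteq> H d) \<and>
     (\<forall>i d. \<delta> (Suc i) ` FH (Suc i) d \<subseteq> FH i d)"

end

theory Submission
  imports Defs
begin

text \<open>
  Write \<open>I\<close> for the kernel of \<open>\<phi>\<close> and \<open>d\<^sub>i: F\<^sub>i \<rightarrow> F\<^sub>i\<^sub>-\<^sub>1\<close> for the differentials. An element \<open>b\<close> of \<open>Q\<close> lies
  outside the Burch ideal \<open>B\<close> iff there is some \<open>s\<close> with \<open>s n \<subseteq> I\<close>, so that \<open>s\<close> maps into the socle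
  of \<open>R\<close>, and \<open>s b \<notin> I n\<close>.

  The proof compares \<open>m\<close>-multiples of cycles over \<open>R\<close> with the ideal \<open>I n\<close> of \<open>Q\<close>. Let \<open>f \<in> F\<^sub>i\<close>, let \<open>b\<close> be
  a lift to \<open>Q\<close> of a coordinate of \<open>d\<^sub>i f\<close>, and let \<open>t \<in> n\<close>. If \<open>t f \<in> m ker d\<^sub>i\<close>, then \<open>t b \<in> I n\<close>, as one sees
  by lifting a matrix of \<open>d\<^sub>i\<close> to one with entries in \<open>n\<close> (lemma \<open>lift_mult_in_In\<close>). Consequently, if
  some coordinate of \<open>d\<^sub>i f\<close> lifts to \<open>b \<notin> B\<close>, then for a suitable socle element \<open>s\<close> the cycle \<open>s f\<close> is
  killed by \<open>m\<close> and is not in \<open>m ker d\<^sub>i\<close>; such an element generates a direct summand \<open>k\<close> of \<open>ker d\<^sub>i\<close>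
  (lemma \<open>k_rank_ge_one\<close>). It remains to find, for \<open>p \<ge> 4\<close>, a boundary in \<open>F\<^sub>p\<^sub>-\<^sub>1\<close> with such a coordinate.

  Let \<open>x\<^sub>1, x\<^sub>2 \<in> n\<close> be linearly independent modulo \<open>B\<close>, and choose \<open>s\<close> with \<open>s n \<subseteq> I\<close> and \<open>s x\<^sub>1 \<notin> I n\<close>. As
  \<open>M\<close> is not free and \<open>R\<close> has a nonzero socle, no \<open>F\<^sub>i\<close> vanishes; let \<open>e\<close> be a basis element of \<open>F\<^sub>p\<^sub>-\<^sub>3\<close>.
  Since \<open>p - 3 \<ge> 1\<close>, minimality makes \<open>s e\<close> a cycle, say \<open>s e = d y\<close>. The elements \<open>x\<^sub>1 y\<close> and \<open>x\<^sub>2 y\<close> are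
  cycles, say \<open>x\<^sub>i y = d v\<^sub>i\<close> with \<open>v\<^sub>i \<in> F\<^sub>p\<^sub>-\<^sub>1\<close>. Because \<open>s x\<^sub>1 \<notin> I n\<close>, the comparison shows that \<open>x\<^sub>1 y\<close>
  is not in \<open>m ker d\<close>, so \<open>v\<^sub>1\<close> has a coordinate \<open>a \<notin> m\<close>. Let \<open>b\<close> be the same coordinate of \<open>v\<^sub>2\<close>. The cycle
  \<open>x\<^sub>2 v\<^sub>1 - x\<^sub>1 v\<^sub>2\<close>, which is the trivial relation between \<open>x\<^sub>1 y\<close> and \<open>x\<^sub>2 y\<close>, is a boundary; its coordinate
  \<open>x\<^sub>2 a - x\<^sub>1 b\<close> lifts to an element outside \<open>B\<close> by independence of \<open>x\<^sub>1\<close> and \<open>x\<^sub>2\<close>.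

  The argument is the same in the local and in the graded-local setting, where \<open>n\<close> and \<open>m\<close> are again
  maximal ideals (lemma \<open>graded_local_ring_maximalideal\<close>).
\<close>

section \<open>Residue field summands generated by socle elements\<close>

text \<open>The form in which maximality of an ideal is used below: an element outside it is invertible
  modulo it. It serves local and graded-local rings alike.\<close>
lemma (in cring) maximalideal_inverse:
  assumes "maximalideal m R" "r \<in> carrier R" "r \<notin> m"
  obtains r' \<mu> where "r' \<in> carrier R" "\<mu> \<in> m" "r' \<otimes> r \<oplus> \<mu> = \<one>"
proof -
  interpret m: maximalideal m R by (rule assms(1))
  have id: "ideal (m <+> PIdl r) R"
    by (intro add_ideals m.is_ideal cgenideal_ideal assms)
  have "\<zero> \<oplus> r \<in> m <+> PIdl r"
    unfolding set_add_def' using m.zero_closed cgenideal_self[OF assms(2)] by blast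
  then have "r \<in> m <+> PIdl r" using assms(2) by simp
  moreover have "m \<subseteq> m <+> PIdl r"
  proof
    fix x assume x: "x \<in> m"
    then have "x \<oplus> \<zero> \<in> m <+> PIdl r"
      using additive_subgroup.zero_closed[OF ideal.axioms(1)[OF cgenideal_ideal[OF assms(2)]]]
      unfolding set_add_def' by blast
    then show "x \<in> m <+> PIdl r" using x m.a_subset by auto
  qed
  moreover have "m <+> PIdl r \<subseteq> carrier R"
    using id by (meson additive_subgroup.a_subset ideal.axioms(1))
  ultimately have "m <+> PIdl r = carrier R"
    using m.I_maximal[OF id] assms(3) by blast
  then have "\<one> \<in> m <+> PIdl r" by simp
  then obtain \<mu> r' where "\<mu> \<in> m" "r' \<in> carrier R" "\<one> = \<mu> \<oplus> r' \<otimes> r"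
    unfolding set_add_def' cgenideal_def by auto
  then show ?thesis
    using that[of r' \<mu>] assms(2) m.a_subset by (auto simp: a_comm subsetD)
qed

lemma submodule_intro:
  assumes "module R M" "N \<subseteq> carrier M" "\<zero>\<^bsub>M\<^esub> \<in> N"
    and "\<And>v w. v \<in> N \<Longrightarrow> w \<in> N \<Longrightarrow> v \<oplus>\<^bsub>M\<^esub> w \<in> N"
    and "\<And>c v. c \<in> carrier R \<Longrightarrow> v \<in> N \<Longrightarrow> c \<odot>\<^bsub>M\<^esub> v \<in> N"
  shows "LinearCombinations.submodule R N M"
  using assms by (simp add: LinearCombinations.submodule_def)

lemma submodule_neg:
  assumes "LinearCombinations.submodule R N M" "v \<in> N"
  shows "\<ominus>\<^bsub>M\<^esub> v \<in> N"
proof -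
  interpret N: LinearCombinations.submodule R N M by (rule assms(1))
  interpret M: module R M by (rule N.module)
  have "\<ominus>\<^bsub>M\<^esub> v = (\<ominus>\<^bsub>R\<^esub> \<one>\<^bsub>R\<^esub>) \<odot>\<^bsub>M\<^esub> v"
    using M.smult_l_minus[of "\<one>\<^bsub>R\<^esub>" v] assms(2) N.subset by auto
  then show ?thesis using N.smult_closed[of "\<ominus>\<^bsub>R\<^esub> \<one>\<^bsub>R\<^esub>" v] assms(2) by simp
qed

lemma ideal_smult_subset:
  assumes "LinearCombinations.submodule R C M"
    and "\<And>a x. a \<in> I \<Longrightarrow> x \<in> carrier M \<Longrightarrow> a \<odot>\<^bsub>M\<^esub> x \<in> C"
  shows "ideal_smult R I M \<subseteq> C"
  unfolding ideal_smult_def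
proof (rule module.span_is_subset[OF submodule.module[OF assms(1)] _ assms(1)])
  show "{a \<odot>\<^bsub>M\<^esub> x |a x. a \<in> I \<and> x \<in> carrier M} \<subseteq> C" using assms(2) by auto
qed

lemma ideal_smult_mem:
  assumes "module R M" "I \<subseteq> carrier R" "a \<in> I" "x \<in> carrier M"
  shows "a \<odot>\<^bsub>M\<^esub> x \<in> ideal_smult R I M"
proof -
  interpret module R M by (rule assms(1))
  have "{a \<odot>\<^bsub>M\<^esub> x |a x. a \<in> I \<and> x \<in> carrier M} \<subseteq> carrier M" using assms(2) by auto
  from in_own_span[OF this] show ?thesis unfolding ideal_smult_def using assms by blast
qed

lemma ideal_smult_submodule:
  assumes "module R M" "I \<subseteq> carrier R"
  shows "LinearCombinations.submodule R (ideal_smult R I M) M"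
proof -
  interpret module R M by (rule assms(1))
  show ?thesis unfolding ideal_smult_def
    by (rule span_is_submodule) (use assms(2) in auto)
qed

lemma a_kernel_iff: "x \<in> a_kernel A B f \<longleftrightarrow> x \<in> carrier A \<and> f x = \<zero>\<^bsub>B\<^esub>"
  unfolding a_kernel_def' by blast

lemma kernel_submodule:
  assumes "module R M" "module R N" "f \<in> module_hom R M N"
  shows "LinearCombinations.submodule R (a_kernel M N f) M"
proof -
  interpret mod_hom R M N f
    using assms by (simp add: mod_hom_def mod_hom_axioms_def)
  show ?thesis using ker_is_submodule unfolding ker_def a_kernel_def' .
qed

text \<open>Zorn's lemma: avoiding a given element is inherited by unions of chains.\<close>
lemma maximal_submodule_avoiding:
  assumes "LinearCombinations.submodule R B N" "z \<notin> B"
  obtains C where "LinearCombinations.submodule R C N" "B \<subseteq> C" "z \<notin> C"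
    "\<And>D. LinearCombinations.submodule R D N \<Longrightarrow> C \<subseteq> D \<Longrightarrow> z \<notin> D \<Longrightarrow> D = C"
proof -
  let ?\<A> = "{C. LinearCombinations.submodule R C N \<and> B \<subseteq> C \<and> z \<notin> C}"
  have "\<exists>U\<in>?\<A>. \<forall>X\<in>\<C>. X \<subseteq> U" if ch: "subset.chain ?\<A> \<C>" for \<C>
  proof (cases "\<C> = {}")
    case True
    then show ?thesis using assms by auto
  next
    case False
    have sub: "X \<in> \<C> \<Longrightarrow> X \<in> ?\<A>" for X using ch unfolding subset.chain_def by blast
    have tot: "X \<in> \<C> \<Longrightarrow> Y \<in> \<C> \<Longrightarrow> X \<subseteq> Y \<or> Y \<subseteq> X" for X Y
      using ch by (meson subset.chain_total subset_chain_def)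
    have "LinearCombinations.submodule R (\<Union>\<C>) N"
    proof (rule submodule_intro)
      show "module R N" by (rule submodule.module[OF assms(1)])
      show "\<Union>\<C> \<subseteq> carrier N" using sub submodule.subset by blast
      show "\<zero>\<^bsub>N\<^esub> \<in> \<Union>\<C>" using False sub submodule.zero_closed by blast
      show "v \<oplus>\<^bsub>N\<^esub> w \<in> \<Union>\<C>" if vw: "v \<in> \<Union>\<C>" "w \<in> \<Union>\<C>" for v w
      proof -
        from vw obtain X Y where XY: "X \<in> \<C>" "Y \<in> \<C>" "v \<in> X" "w \<in> Y" by blast
        then obtain Z where Z: "Z \<in> \<C>" "v \<in> Z" "w \<in> Z" using tot[OF XY(1,2)] by blast
        then have "LinearCombinations.submodule R Z N" using sub by blast
        from submodule.m_closed[OF this Z(2,3)] show ?thesis using Z(1) by blast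
      qed
      show "c \<odot>\<^bsub>N\<^esub> v \<in> \<Union>\<C>" if "c \<in> carrier R" "v \<in> \<Union>\<C>" for c v
      proof -
        from that obtain Z where Z: "Z \<in> \<C>" "v \<in> Z" by blast
        then have "LinearCombinations.submodule R Z N" using sub by blast
        from submodule.smult_closed[OF this that(1) Z(2)] show ?thesis using Z(1) by blast
      qed
    qed
    then have "\<Union>\<C> \<in> ?\<A>" using sub False by blast
    then show ?thesis by blast
  qed
  then have "\<exists>C\<in>?\<A>. \<forall>X\<in>?\<A>. C \<subseteq> X \<longrightarrow> X = C" by (rule subset_Zorn)
  then obtain C where C: "C \<in> ?\<A>" and max: "\<forall>X\<in>?\<A>. C \<subseteq> X \<longrightarrow> X = C" ..
  show ?thesis
  proof (rule that[of C])
    fix D assume D: "LinearCombinations.submodule R D N" "C \<subseteq> D" "z \<notin> D"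
    then have "D \<in> ?\<A>" using C by blast
    then show "D = C" using max D(2) by simp
  qed (use C in simp_all)
qed

text \<open>Modulo \<open>m N\<close> the module is a vector space over \<open>k\<close> in which \<open>z\<close> has a nonzero image, and the
  complement is a hyperplane missing \<open>z\<close>. It is obtained as a submodule \<open>C\<close> containing \<open>m N\<close> that
  is maximal among those avoiding \<open>z\<close>: for \<open>u \<notin> C\<close> the submodule \<open>C + R u\<close> contains \<open>z = c + r u\<close>,
  where \<open>r \<notin> m\<close> because \<open>m u \<subseteq> C\<close>, and inverting \<open>r\<close> modulo \<open>m\<close> puts \<open>u\<close> into \<open>R z + C\<close>.\<close>
lemma socle_element_complement:
  assumes N: "module R N" and m: "maximalideal m R"
    and z: "z \<in> carrier N" "z \<notin> ideal_smult R m N"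
    and ann: "\<And>a. a \<in> m \<Longrightarrow> a \<odot>\<^bsub>N\<^esub> z = \<zero>\<^bsub>N\<^esub>"
  shows "direct_summand R {r \<odot>\<^bsub>N\<^esub> z |r. r \<in> carrier R} N"
proof -
  interpret N: module R N by (rule N)
  interpret m: maximalideal m R by (rule m)
  let ?A = "{r \<odot>\<^bsub>N\<^esub> z |r. r \<in> carrier R}"
  have mc: "m \<subseteq> carrier R" using m.a_subset .
  obtain C where C: "LinearCombinations.submodule R C N" "ideal_smult R m N \<subseteq> C" "z \<notin> C"
    and max: "\<And>D. LinearCombinations.submodule R D N \<Longrightarrow> C \<subseteq> D \<Longrightarrow> z \<notin> D \<Longrightarrow> D = C"
    using maximal_submodule_avoiding[OF ideal_smult_submodule[OF N mc] z(2)] by metis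
  interpret C: LinearCombinations.submodule R C N by (rule C(1))
  have subA: "LinearCombinations.submodule R ?A N"
  proof (rule submodule_intro[OF N])
    show "?A \<subseteq> carrier N" using z by auto
    show "\<zero>\<^bsub>N\<^esub> \<in> ?A" using N.smult_l_null[OF z(1)] by (auto intro!: exI[of _ "\<zero>\<^bsub>R\<^esub>"])
    show "v \<oplus>\<^bsub>N\<^esub> w \<in> ?A" if "v \<in> ?A" "w \<in> ?A" for v w
    proof -
      from that obtain r s where "r \<in> carrier R" "s \<in> carrier R" "v = r \<odot>\<^bsub>N\<^esub> z" "w = s \<odot>\<^bsub>N\<^esub> z"
        by blast
      then have "r \<oplus>\<^bsub>R\<^esub> s \<in> carrier R" "v \<oplus>\<^bsub>N\<^esub> w = (r \<oplus>\<^bsub>R\<^esub> s) \<odot>\<^bsub>N\<^esub> z"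
        using z(1) by (simp_all add: N.smult_l_distr)
      then show ?thesis by blast
    qed
    show "c \<odot>\<^bsub>N\<^esub> v \<in> ?A" if "c \<in> carrier R" "v \<in> ?A" for c v
    proof -
      from that obtain r where "r \<in> carrier R" "v = r \<odot>\<^bsub>N\<^esub> z" by blast
      then have "c \<otimes>\<^bsub>R\<^esub> r \<in> carrier R" "c \<odot>\<^bsub>N\<^esub> v = (c \<otimes>\<^bsub>R\<^esub> r) \<odot>\<^bsub>N\<^esub> z"
        using z(1) that by (simp_all add: N.smult_assoc1)
      then show ?thesis by blast
    qed
  qed
  have int: "?A \<inter> C = {\<zero>\<^bsub>N\<^esub>}"
  proof -
    have "r \<odot>\<^bsub>N\<^esub> z = \<zero>\<^bsub>N\<^esub>" if r: "r \<in> carrier R" "r \<odot>\<^bsub>N\<^esub> z \<in> C" for r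
    proof (cases "r \<in> m")
      case False
      obtain r' \<mu> where r': "r' \<in> carrier R" "\<mu> \<in> m" "r' \<otimes>\<^bsub>R\<^esub> r \<oplus>\<^bsub>R\<^esub> \<mu> = \<one>\<^bsub>R\<^esub>"
        using N.R.maximalideal_inverse[OF m r(1) False] .
      have "z = (r' \<otimes>\<^bsub>R\<^esub> r \<oplus>\<^bsub>R\<^esub> \<mu>) \<odot>\<^bsub>N\<^esub> z" using r' z by simp
      also have "\<dots> = r' \<odot>\<^bsub>N\<^esub> (r \<odot>\<^bsub>N\<^esub> z)"
        using r'(1,2) r z mc by (simp add: N.smult_l_distr N.smult_assoc1 ann subsetD)
      finally have "z \<in> C" using r r' C.smult_closed by metis
      with C(3) show ?thesis by simp
    qed (simp add: ann)
    then show ?thesis using submodule.zero_closed[OF subA] C.zero_closed by blast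
  qed
  have sum: "N.submodule_sum ?A C = carrier N"
  proof
    show "N.submodule_sum ?A C \<subseteq> carrier N"
      using z C.subset unfolding N.submodule_sum_def by auto
    show "carrier N \<subseteq> N.submodule_sum ?A C"
    proof
      fix u assume u: "u \<in> carrier N"
      have "\<exists>r\<in>carrier R. \<exists>c\<in>C. u = r \<odot>\<^bsub>N\<^esub> z \<oplus>\<^bsub>N\<^esub> c"
      proof (cases "u \<in> C")
        case True
        then show ?thesis using z by (intro bexI[of _ "\<zero>\<^bsub>R\<^esub>"] bexI[of _ u]) (auto simp: u)
      next
        case False
        let ?D = "{c \<oplus>\<^bsub>N\<^esub> r \<odot>\<^bsub>N\<^esub> u |c r. c \<in> C \<and> r \<in> carrier R}"
        have Cc: "c \<in> C \<Longrightarrow> c \<in> carrier N" for c using C.subset by blast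
        have "LinearCombinations.submodule R ?D N"
        proof (rule submodule_intro[OF N])
          show "?D \<subseteq> carrier N" using u Cc by auto
          show "\<zero>\<^bsub>N\<^esub> \<in> ?D" using u by (auto intro!: exI[of _ "\<zero>\<^bsub>N\<^esub>"] exI[of _ "\<zero>\<^bsub>R\<^esub>"])
          show "v \<oplus>\<^bsub>N\<^esub> w \<in> ?D" if vw: "v \<in> ?D" "w \<in> ?D" for v w
          proof -
            from vw obtain c r c' r' where *: "c \<in> C" "r \<in> carrier R" "v = c \<oplus>\<^bsub>N\<^esub> r \<odot>\<^bsub>N\<^esub> u"
              "c' \<in> C" "r' \<in> carrier R" "w = c' \<oplus>\<^bsub>N\<^esub> r' \<odot>\<^bsub>N\<^esub> u" by blast
            then have "v \<oplus>\<^bsub>N\<^esub> w = (c \<oplus>\<^bsub>N\<^esub> c') \<oplus>\<^bsub>N\<^esub> (r \<oplus>\<^bsub>R\<^esub> r') \<odot>\<^bsub>N\<^esub> u"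
              using u Cc by (simp add: N.smult_l_distr N.M.a_ac)
            then show ?thesis using * by blast
          qed
          show "a \<odot>\<^bsub>N\<^esub> v \<in> ?D" if av: "a \<in> carrier R" "v \<in> ?D" for a v
          proof -
            from av obtain c r where *: "c \<in> C" "r \<in> carrier R" "v = c \<oplus>\<^bsub>N\<^esub> r \<odot>\<^bsub>N\<^esub> u" by blast
            then have "a \<odot>\<^bsub>N\<^esub> v = (a \<odot>\<^bsub>N\<^esub> c) \<oplus>\<^bsub>N\<^esub> (a \<otimes>\<^bsub>R\<^esub> r) \<odot>\<^bsub>N\<^esub> u"
              using u Cc av by (simp add: N.smult_r_distr N.smult_assoc1)
            then show ?thesis using * av by blast
          qed
        qed
        moreover have "C \<subseteq> ?D"
        proof
          fix c assume "c \<in> C"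
          then have "c = c \<oplus>\<^bsub>N\<^esub> \<zero>\<^bsub>R\<^esub> \<odot>\<^bsub>N\<^esub> u" using u Cc by simp
          then show "c \<in> ?D" using \<open>c \<in> C\<close> by blast
        qed
        moreover have "u \<in> ?D"
          using u by (auto intro!: exI[of _ "\<zero>\<^bsub>N\<^esub>"] exI[of _ "\<one>\<^bsub>R\<^esub>"])
        ultimately have "z \<in> ?D" using max False by blast
        then obtain c r where cr: "c \<in> C" "r \<in> carrier R" "z = c \<oplus>\<^bsub>N\<^esub> r \<odot>\<^bsub>N\<^esub> u" by blast
        have mC: "a \<odot>\<^bsub>N\<^esub> u \<in> C" if "a \<in> m" for a
          using ideal_smult_mem[OF N mc that u] C(2) by blast
        have "r \<notin> m" using cr mC C(3) by auto
        obtain r' \<mu> where r': "r' \<in> carrier R" "\<mu> \<in> m" "r' \<otimes>\<^bsub>R\<^esub> r \<oplus>\<^bsub>R\<^esub> \<mu> = \<one>\<^bsub>R\<^esub>"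
          using N.R.maximalideal_inverse[OF m cr(2) \<open>r \<notin> m\<close>] .
        have \<mu>: "\<mu> \<in> carrier R" using r' mc by blast
        have ru: "r \<odot>\<^bsub>N\<^esub> u = z \<oplus>\<^bsub>N\<^esub> (\<ominus>\<^bsub>N\<^esub> c)"
        proof -
          have "z \<oplus>\<^bsub>N\<^esub> (\<ominus>\<^bsub>N\<^esub> c) = (r \<odot>\<^bsub>N\<^esub> u \<oplus>\<^bsub>N\<^esub> c) \<oplus>\<^bsub>N\<^esub> (\<ominus>\<^bsub>N\<^esub> c)"
            using cr u Cc by (simp add: N.M.a_comm)
          also have "\<dots> = r \<odot>\<^bsub>N\<^esub> u"
            using cr(1,2) u Cc by (simp add: N.M.a_assoc N.M.r_neg)
          finally show ?thesis ..
        qed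
        have nc: "\<ominus>\<^bsub>N\<^esub> c \<in> C" using submodule_neg[OF C(1) cr(1)] .
        have "u = (r' \<otimes>\<^bsub>R\<^esub> r \<oplus>\<^bsub>R\<^esub> \<mu>) \<odot>\<^bsub>N\<^esub> u" using r' u by simp
        also have "\<dots> = r' \<odot>\<^bsub>N\<^esub> (z \<oplus>\<^bsub>N\<^esub> (\<ominus>\<^bsub>N\<^esub> c)) \<oplus>\<^bsub>N\<^esub> \<mu> \<odot>\<^bsub>N\<^esub> u"
          using r'(1,2) \<mu> cr(1,2) u by (simp add: N.smult_l_distr N.smult_assoc1 flip: ru)
        also have "\<dots> = r' \<odot>\<^bsub>N\<^esub> z \<oplus>\<^bsub>N\<^esub> (r' \<odot>\<^bsub>N\<^esub> (\<ominus>\<^bsub>N\<^esub> c) \<oplus>\<^bsub>N\<^esub> \<mu> \<odot>\<^bsub>N\<^esub> u)"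
          using r' \<mu> nc Cc u z by (simp add: N.smult_r_distr N.M.a_assoc)
        finally have "u = r' \<odot>\<^bsub>N\<^esub> z \<oplus>\<^bsub>N\<^esub> (r' \<odot>\<^bsub>N\<^esub> (\<ominus>\<^bsub>N\<^esub> c) \<oplus>\<^bsub>N\<^esub> \<mu> \<odot>\<^bsub>N\<^esub> u)" .
        moreover have "r' \<odot>\<^bsub>N\<^esub> (\<ominus>\<^bsub>N\<^esub> c) \<oplus>\<^bsub>N\<^esub> \<mu> \<odot>\<^bsub>N\<^esub> u \<in> C"
          by (intro C.m_closed C.smult_closed nc mC r'(1,2))
        ultimately show ?thesis using r'(1) by (intro bexI)
      qed
      then obtain r c where "r \<in> carrier R" "c \<in> C" "u = r \<odot>\<^bsub>N\<^esub> z \<oplus>\<^bsub>N\<^esub> c" by blast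
      then show "u \<in> N.submodule_sum ?A C"
        unfolding N.submodule_sum_def by (intro image_eqI[of _ _ "(r \<odot>\<^bsub>N\<^esub> z, c)"]) auto
    qed
  qed
  show ?thesis unfolding direct_summand_def using subA int sum C(1) by blast
qed

text \<open>The annihilator of \<open>z\<close> contains \<open>m\<close> and, as \<open>z \<noteq> 0\<close>, equals it; so \<open>r + m \<mapsto> r z\<close> identifies \<open>k\<close>
  with \<open>R z\<close>, which is a direct summand.\<close>
lemma k_rank_ge_one:
  assumes N: "module R N" and m: "maximalideal m R"
    and z: "z \<in> carrier N" "z \<notin> ideal_smult R m N"
    and ann: "\<And>a. a \<in> m \<Longrightarrow> a \<odot>\<^bsub>N\<^esub> z = \<zero>\<^bsub>N\<^esub>"
  shows "k_rank R m N \<ge> 1"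
proof -
  interpret N: module R N by (rule N)
  interpret m: maximalideal m R by (rule m)
  let ?A = "{r \<odot>\<^bsub>N\<^esub> z |r. r \<in> carrier R}"
  let ?P = "residue_power R m 1"
  have mc: "m \<subseteq> carrier R" using m.a_subset .
  interpret K: ring "R Quot m" by (rule m.quotient_is_ring)
  have Pc: "carrier ?P = {..<1} \<rightarrow>\<^sub>E (a_rcosets\<^bsub>R\<^esub> m)"
    unfolding residue_power_def restrict_scalars_def K.func_space_def by (simp add: FactRing_def)
  have Padd: "h \<oplus>\<^bsub>?P\<^esub> h' = (\<lambda>v\<in>{..<1}. h v <+>\<^bsub>R\<^esub> h' v)" for h h'
    unfolding residue_power_def restrict_scalars_def K.func_space_def by (simp add: FactRing_def)
  have Psm: "r \<odot>\<^bsub>?P\<^esub> h = (\<lambda>v\<in>{..<1}. rcoset_mult R m (m +>\<^bsub>R\<^esub> r) (h v))" for r h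
    unfolding residue_power_def restrict_scalars_def K.func_space_def by (simp add: FactRing_def)
  \<comment> \<open>The element of \<open>k\<^sup>1\<close> with coordinate \<open>r + m\<close>; every element has this form.\<close>
  define \<gamma> where "\<gamma> r = (\<lambda>v\<in>{..<1::nat}. m +>\<^bsub>R\<^esub> r)" for r
  define f where "f h = (SOME r. r \<in> carrier R \<and> r \<in> h (0::nat)) \<odot>\<^bsub>N\<^esub> z" for h
  have Pc': "carrier ?P = \<gamma> ` carrier R"
  proof
    show "carrier ?P \<subseteq> \<gamma> ` carrier R"
    proof
      fix h assume h: "h \<in> carrier ?P"
      then have "h 0 \<in> a_rcosets\<^bsub>R\<^esub> m" unfolding Pc by auto
      then obtain r where "r \<in> carrier R" "h 0 = m +>\<^bsub>R\<^esub> r" unfolding A_RCOSETS_def' by auto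
      moreover have "h = (\<lambda>v\<in>{..<1}. h 0)" using h unfolding Pc by (intro extensionalityI[of _ "{..<1}"]) (auto simp: PiE_def)
      ultimately show "h \<in> \<gamma> ` carrier R" unfolding \<gamma>_def by auto
    qed
    show "\<gamma> ` carrier R \<subseteq> carrier ?P"
      unfolding Pc \<gamma>_def using N.R.a_rcosetsI[OF mc] by auto
  qed
  have eqz: "r \<odot>\<^bsub>N\<^esub> z = s \<odot>\<^bsub>N\<^esub> z \<longleftrightarrow> m +>\<^bsub>R\<^esub> r = m +>\<^bsub>R\<^esub> s" if rs: "r \<in> carrier R" "s \<in> carrier R" for r s
  proof
    assume "m +>\<^bsub>R\<^esub> r = m +>\<^bsub>R\<^esub> s"
    then have "r \<in> m +>\<^bsub>R\<^esub> s" using m.a_rcos_self[OF rs(1)] by simp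
    then obtain \<mu> where "\<mu> \<in> m" "r = \<mu> \<oplus>\<^bsub>R\<^esub> s" unfolding a_r_coset_def' by auto
    then show "r \<odot>\<^bsub>N\<^esub> z = s \<odot>\<^bsub>N\<^esub> z" using rs z mc by (simp add: N.smult_l_distr ann subsetD)
  next
    assume eq: "r \<odot>\<^bsub>N\<^esub> z = s \<odot>\<^bsub>N\<^esub> z"
    have "(r \<ominus>\<^bsub>R\<^esub> s) \<odot>\<^bsub>N\<^esub> z = \<zero>\<^bsub>N\<^esub>"
      using rs z eq by (simp add: N.R.minus_eq N.smult_l_distr N.smult_l_minus N.M.r_neg)
    moreover have "c \<in> m" if c: "c \<in> carrier R" "c \<odot>\<^bsub>N\<^esub> z = \<zero>\<^bsub>N\<^esub>" for c
    proof (rule ccontr)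
      assume "c \<notin> m"
      obtain r' \<mu> where r': "r' \<in> carrier R" "\<mu> \<in> m" "r' \<otimes>\<^bsub>R\<^esub> c \<oplus>\<^bsub>R\<^esub> \<mu> = \<one>\<^bsub>R\<^esub>"
        using N.R.maximalideal_inverse[OF m c(1) \<open>c \<notin> m\<close>] .
      have "z = (r' \<otimes>\<^bsub>R\<^esub> c \<oplus>\<^bsub>R\<^esub> \<mu>) \<odot>\<^bsub>N\<^esub> z" using r' z by simp
      also have "\<dots> = \<zero>\<^bsub>N\<^esub>" using r'(1,2) c z mc by (simp add: N.smult_l_distr N.smult_assoc1 ann subsetD)
      finally show False
        using z(2) submodule.zero_closed[OF ideal_smult_submodule[OF N mc]] by simp
    qed
    ultimately have "r \<ominus>\<^bsub>R\<^esub> s \<in> m" using rs by simp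
    then have "r \<in> m +>\<^bsub>R\<^esub> s" using m.a_rcos_module_minus[OF N.R.ring_axioms rs(2,1)] by simp
    then show "m +>\<^bsub>R\<^esub> r = m +>\<^bsub>R\<^esub> s" using m.a_repr_independence'[OF _ rs(2)] by simp
  qed
  have f\<gamma>: "f (\<gamma> r) = r \<odot>\<^bsub>N\<^esub> z" if r: "r \<in> carrier R" for r
  proof -
    let ?s = "SOME s. s \<in> carrier R \<and> s \<in> \<gamma> r 0"
    have "r \<in> carrier R \<and> r \<in> \<gamma> r 0" using r m.a_rcos_self[OF r] unfolding \<gamma>_def by simp
    from someI[of "\<lambda>s. s \<in> carrier R \<and> s \<in> \<gamma> r 0", OF this]
    have s: "?s \<in> carrier R" "?s \<in> m +>\<^bsub>R\<^esub> r" unfolding \<gamma>_def by auto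
    then have "m +>\<^bsub>R\<^esub> ?s = m +>\<^bsub>R\<^esub> r" using m.a_repr_independence'[OF s(2) r] by simp
    then show ?thesis unfolding f_def using eqz[OF s(1) r] by simp
  qed
  have add\<gamma>: "\<gamma> r \<oplus>\<^bsub>?P\<^esub> \<gamma> s = \<gamma> (r \<oplus>\<^bsub>R\<^esub> s)" if "r \<in> carrier R" "s \<in> carrier R" for r s
    unfolding Padd unfolding \<gamma>_def using that by (intro restrict_ext) (simp add: m.a_rcos_sum)
  have sm\<gamma>: "r \<odot>\<^bsub>?P\<^esub> \<gamma> s = \<gamma> (r \<otimes>\<^bsub>R\<^esub> s)" if "r \<in> carrier R" "s \<in> carrier R" for r s
    unfolding Psm unfolding \<gamma>_def using that by (intro restrict_ext) (simp add: m.rcoset_mult_add)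
  have "f \<in> module_hom R ?P (N\<lparr>carrier := ?A\<rparr>)"
    unfolding module_hom_def Pc' using z
    by (auto simp: f\<gamma> add\<gamma> sm\<gamma> N.smult_l_distr N.smult_assoc1 simp del: One_nat_def)
  moreover have "bij_betw f (carrier ?P) ?A"
  proof (rule bij_betw_imageI)
    show "inj_on f (carrier ?P)"
    proof (rule inj_onI)
      fix g h assume "g \<in> carrier ?P" "h \<in> carrier ?P" and eq: "f g = f h"
      then obtain r s where rs: "r \<in> carrier R" "s \<in> carrier R" "g = \<gamma> r" "h = \<gamma> s"
        unfolding Pc' by auto
      with eq have "m +>\<^bsub>R\<^esub> r = m +>\<^bsub>R\<^esub> s" by (simp add: f\<gamma> eqz)
      then show "g = h" unfolding rs \<gamma>_def by simp
    qed
    have "f ` carrier ?P = (\<lambda>r. r \<odot>\<^bsub>N\<^esub> z) ` carrier R"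
      unfolding Pc' image_image by (intro image_cong refl f\<gamma>)
    then show "f ` carrier ?P = ?A" by blast
  qed
  ultimately have "module_iso R ?P (N\<lparr>carrier := ?A\<rparr>)"
    unfolding module_iso_def by auto
  then have "enat 1 \<in> {enat n |n. \<exists>A. direct_summand R A N \<and>
      module_iso R (residue_power R m n) (N\<lparr>carrier := A\<rparr>)}"
    using socle_element_complement[OF assms] by blast
  then show ?thesis unfolding k_rank_def one_enat_def by (rule Sup_upper)
qed

section \<open>Coordinates on free modules\<close>

definition linear_form :: "('a, 'b) ring_scheme \<Rightarrow> ('a, 'c, 'd) module_scheme \<Rightarrow> ('c \<Rightarrow> 'a) \<Rightarrow> bool" where
  "linear_form R V f \<longleftrightarrow> f \<in> carrier V \<rightarrow> carrier R \<and>
     (\<forall>u \<in> carrier V. \<forall>v \<in> carrier V. f (u \<oplus>\<^bsub>V\<^esub> v) = f u \<oplus>\<^bsub>R\<^esub> f v) \<and>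
     (\<forall>r \<in> carrier R. \<forall>v \<in> carrier V. f (r \<odot>\<^bsub>V\<^esub> v) = r \<otimes>\<^bsub>R\<^esub> f v)"

lemma linear_formD:
  assumes "linear_form R V f"
  shows "u \<in> carrier V \<Longrightarrow> f u \<in> carrier R"
    and "u \<in> carrier V \<Longrightarrow> v \<in> carrier V \<Longrightarrow> f (u \<oplus>\<^bsub>V\<^esub> v) = f u \<oplus>\<^bsub>R\<^esub> f v"
    and "r \<in> carrier R \<Longrightarrow> u \<in> carrier V \<Longrightarrow> f (r \<odot>\<^bsub>V\<^esub> u) = r \<otimes>\<^bsub>R\<^esub> f u"
  using assms by (auto simp: linear_form_def)

lemma (in module) linear_form_zero:
  assumes "linear_form R M f"
  shows "f \<zero>\<^bsub>M\<^esub> = \<zero>"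
proof -
  have "f (\<zero> \<odot>\<^bsub>M\<^esub> \<zero>\<^bsub>M\<^esub>) = \<zero> \<otimes> f \<zero>\<^bsub>M\<^esub>" by (rule linear_formD(3)[OF assms]) simp_all
  then show ?thesis using linear_formD(1)[OF assms, of "\<zero>\<^bsub>M\<^esub>"] by simp
qed

lemma (in module) linear_form_lincomb:
  assumes "linear_form R M f" "S \<subseteq> carrier M" "a \<in> S \<rightarrow> carrier R"
  shows "f (lincomb a S) = (\<Oplus>e\<in>S. a e \<otimes> f e)"
proof -
  note lf = linear_formD[OF assms(1)]
  have "f (\<Oplus>\<^bsub>M\<^esub>v\<in>S. a v \<odot>\<^bsub>M\<^esub> v) = (\<Oplus>e\<in>S. a e \<otimes> f e)"
    using assms(2,3)
  proof (induct S rule: infinite_finite_induct)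
    case (insert e S)
    have *: "(\<lambda>v. a v \<odot>\<^bsub>M\<^esub> v) \<in> S \<rightarrow> carrier M" "a e \<odot>\<^bsub>M\<^esub> e \<in> carrier M"
      "(\<lambda>v. a v \<otimes> f v) \<in> S \<rightarrow> carrier R" "a e \<otimes> f e \<in> carrier R"
      using insert.prems lf(1) by (auto simp: Pi_iff)
    have "f (a e \<odot>\<^bsub>M\<^esub> e) = a e \<otimes> f e" using insert.prems lf(3) by auto
    moreover have "f (\<Oplus>\<^bsub>M\<^esub>v\<in>S. a v \<odot>\<^bsub>M\<^esub> v) = (\<Oplus>e\<in>S. a e \<otimes> f e)" using insert by auto
    ultimately show ?case
      using * insert.hyps lf(2) M.finsum_closed[OF *(1)] by simp
  qed (use linear_form_zero[OF assms(1)] in simp_all)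
  then show ?thesis unfolding lincomb_def .
qed

lemma (in module) basis_lincomb_inj:
  assumes "finite S" "S \<subseteq> carrier M" "lin_indpt S"
    and "a \<in> S \<rightarrow> carrier R" "b \<in> S \<rightarrow> carrier R" "lincomb a S = lincomb b S" "e \<in> S"
  shows "a e = b e"
proof -
  have "lincomb (\<lambda>v. a v \<ominus>\<^bsub>R\<^esub> b v) S = \<zero>\<^bsub>M\<^esub>"
    using assms by (simp add: lincomb_diff M.minus_eq M.r_neg)
  moreover have "(\<lambda>v. a v \<ominus>\<^bsub>R\<^esub> b v) \<in> S \<rightarrow> carrier R" using assms(4,5) by (auto simp: Pi_iff)
  ultimately have "a e \<ominus>\<^bsub>R\<^esub> b e = \<zero>"
    using lin_dep_crit[OF assms(1) subset_refl _ assms(7), of "\<lambda>v. a v \<ominus>\<^bsub>R\<^esub> b v"] assms(3) by blast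
  then show ?thesis using assms(4,5,7) by (auto simp: Pi_iff R.r_right_minus_eq)
qed

text \<open>The coordinate functions of a finite basis. A coefficient vector is selected for each element;
  uniqueness of coefficients then makes the selection linear.\<close>
lemma basis_coordinates:
  assumes V: "module R V" and S: "finite S" "module_basis R V S"
  obtains c where "\<And>e. e \<in> S \<Longrightarrow> linear_form R V (c e)"
    and "\<And>v. v \<in> carrier V \<Longrightarrow> module.lincomb V (\<lambda>e. c e v) S = v"
    and "\<And>e. e \<in> S \<Longrightarrow> c e e = \<one>\<^bsub>R\<^esub>"
proof -
  interpret V: module R V by (rule V)
  have S': "S \<subseteq> carrier V" "V.lin_indpt S" "V.span S = carrier V"
    using S(2) by (auto simp: module_basis_def)
  define k where "k v = (SOME a. a \<in> S \<rightarrow> carrier R \<and> V.lincomb a S = v)" for v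
  have k: "k v \<in> S \<rightarrow> carrier R" "V.lincomb (k v) S = v" if "v \<in> carrier V" for v
  proof -
    have "\<exists>a. a \<in> S \<rightarrow> carrier R \<and> V.lincomb a S = v"
      using V.finite_in_span[OF S(1) S'(1)] that S'(3) by auto
    from someI_ex[OF this] show "k v \<in> S \<rightarrow> carrier R" "V.lincomb (k v) S = v"
      unfolding k_def by auto
  qed
  have uniq: "k v e = a e" if "v \<in> carrier V" "a \<in> S \<rightarrow> carrier R" "V.lincomb a S = v" "e \<in> S" for v a e
    using V.basis_lincomb_inj[OF S(1) S'(1,2) k(1)[OF that(1)] that(2) _ that(4)] k(2)[OF that(1)] that(3)
    by simp
  show ?thesis
  proof (rule that[of "\<lambda>e v. k v e"])
    fix e assume e: "e \<in> S"
    show "linear_form R V (\<lambda>v. k v e)" unfolding linear_form_def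
    proof (intro conjI ballI)
      show "(\<lambda>v. k v e) \<in> carrier V \<rightarrow> carrier R" using k(1) e by auto
      fix u v assume uv: "u \<in> carrier V" "v \<in> carrier V"
      show "k (u \<oplus>\<^bsub>V\<^esub> v) e = k u e \<oplus>\<^bsub>R\<^esub> k v e"
      proof (rule uniq[OF _ _ _ e, of _ "\<lambda>x. k u x \<oplus>\<^bsub>R\<^esub> k v x"])
        show "(\<lambda>x. k u x \<oplus>\<^bsub>R\<^esub> k v x) \<in> S \<rightarrow> carrier R"
          using k(1)[OF uv(1)] k(1)[OF uv(2)] by (auto simp: Pi_iff)
        show "V.lincomb (\<lambda>x. k u x \<oplus>\<^bsub>R\<^esub> k v x) S = u \<oplus>\<^bsub>V\<^esub> v"
          using V.lincomb_sum[OF S(1) S'(1) k(1)[OF uv(1)] k(1)[OF uv(2)]] k(2) uv by simp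
      qed (use uv in simp)
    next
      fix r v assume rv: "r \<in> carrier R" "v \<in> carrier V"
      show "k (r \<odot>\<^bsub>V\<^esub> v) e = r \<otimes>\<^bsub>R\<^esub> k v e"
      proof (rule uniq[OF _ _ _ e, of _ "\<lambda>x. r \<otimes>\<^bsub>R\<^esub> k v x"])
        show "(\<lambda>x. r \<otimes>\<^bsub>R\<^esub> k v x) \<in> S \<rightarrow> carrier R"
          using k(1)[OF rv(2)] rv(1) by (auto simp: Pi_iff)
        show "V.lincomb (\<lambda>x. r \<otimes>\<^bsub>R\<^esub> k v x) S = r \<odot>\<^bsub>V\<^esub> v"
          using V.lincomb_smult[OF S'(1) k(1)[OF rv(2)] rv(1)] k(2) rv by simp
      qed (use rv in simp)
    qed
    let ?d = "\<lambda>x. if x = e then \<one>\<^bsub>R\<^esub> else \<zero>\<^bsub>R\<^esub>"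
    have ec: "e \<in> carrier V" using e S' by auto
    have "V.lincomb ?d S = \<one>\<^bsub>R\<^esub> \<odot>\<^bsub>V\<^esub> e \<oplus>\<^bsub>V\<^esub> V.lincomb ?d (S - {e})"
      by (subst V.lincomb_del2[OF S(1) S'(1) _ e]) auto
    also have "V.lincomb ?d (S - {e}) = \<zero>\<^bsub>V\<^esub>"
      unfolding V.lincomb_def using S' by (intro V.M.finsum_all0) (auto simp: subsetD)
    finally have "V.lincomb ?d S = e" using ec by simp
    then have "k e e = ?d e" by (intro uniq ec e) auto
    then show "k e e = \<one>\<^bsub>R\<^esub>" by simp
  qed (use k in simp)
qed

lemma linear_form_ideal_smult:
  assumes V: "module R V" and m: "ideal m R" and c: "linear_form R V c"
    and w: "w \<in> ideal_smult R m V"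
  shows "c w \<in> m"
proof -
  interpret V: module R V by (rule V)
  interpret m: ideal m R by (rule m)
  note lf = linear_formD[OF c]
  have "LinearCombinations.submodule R {v \<in> carrier V. c v \<in> m} V"
    by (rule submodule_intro[OF V]) (use V.linear_form_zero[OF c] lf in \<open>auto simp: m.I_l_closed\<close>)
  moreover have "a \<odot>\<^bsub>V\<^esub> x \<in> {v \<in> carrier V. c v \<in> m}" if "a \<in> m" "x \<in> carrier V" for a x
    using that lf m.Icarr by (auto simp: m.I_r_closed)
  ultimately have "ideal_smult R m V \<subseteq> {v \<in> carrier V. c v \<in> m}"
    by (rule ideal_smult_subset)
  then show ?thesis using w by auto
qed

section \<open>Lifting linear forms along the surjection\<close>

text \<open>The data common to the local and the graded-local setting. Throughout the locale \<open>In\<close> is the product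
  \<open>I n\<close>, and \<open>socQ\<close> is \<open>I : n\<close>, the preimage of the socle of \<open>R\<close>.\<close>
locale local_surjection = Q: cring Q + R: cring R + n: maximalideal n Q + m: maximalideal m R
  for Q :: "('q, 'a) ring_scheme" and n and R :: "('r, 'b) ring_scheme" and m +
  fixes \<phi> :: "'q \<Rightarrow> 'r"
  assumes surjective_local: "surjective_local_hom Q n R m \<phi>"
begin

sublocale phi: ring_hom_cring Q R \<phi>
  using surjective_local by unfold_locales (simp add: surjective_local_hom_def)

abbreviation "I \<equiv> a_kernel Q R \<phi>"
abbreviation "In \<equiv> ideal_prod Q I n"
abbreviation "socQ \<equiv> colon_ideal Q I n"
abbreviation "BI \<equiv> burch_ideal Q n R \<phi>"

lemma surj:
  assumes "r \<in> carrier R"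
  shows "\<exists>a \<in> carrier Q. \<phi> a = r"
proof -
  have "r \<in> \<phi> ` carrier Q" using surjective_local assms by (simp add: surjective_local_hom_def)
  then show ?thesis by auto
qed

lemma kernel_iff: "x \<in> I \<longleftrightarrow> x \<in> carrier Q \<and> \<phi> x = \<zero>\<^bsub>R\<^esub>"
  by (rule a_kernel_iff)

lemma phi_mem_m_iff:
  assumes "x \<in> carrier Q"
  shows "\<phi> x \<in> m \<longleftrightarrow> x \<in> n"
proof
  show "\<phi> x \<in> m" if "x \<in> n" using that surjective_local by (auto simp: surjective_local_hom_def)
next
  assume *: "\<phi> x \<in> m"
  show "x \<in> n"
  proof (rule ccontr)
    assume "x \<notin> n"
    then obtain y \<nu> where y: "y \<in> carrier Q" "\<nu> \<in> n" "y \<otimes>\<^bsub>Q\<^esub> x \<oplus>\<^bsub>Q\<^esub> \<nu> = \<one>\<^bsub>Q\<^esub>"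
      using Q.maximalideal_inverse[OF n.is_maximalideal assms] by metis
    have "\<phi> \<nu> \<in> m" using y surjective_local by (auto simp: surjective_local_hom_def)
    moreover have "\<phi> (y \<otimes>\<^bsub>Q\<^esub> x \<oplus>\<^bsub>Q\<^esub> \<nu>) = \<phi> y \<otimes>\<^bsub>R\<^esub> \<phi> x \<oplus>\<^bsub>R\<^esub> \<phi> \<nu>"
      using y(1,2) assms n.Icarr by simp
    ultimately have "\<one>\<^bsub>R\<^esub> \<in> m" using y * by (simp add: m.I_l_closed)
    then show False using m.one_imp_carrier m.I_notcarr by auto
  qed
qed

lemma lift_m: "\<mu> \<in> m \<Longrightarrow> \<exists>x \<in> n. \<phi> x = \<mu>"
  using surj[of \<mu>] phi_mem_m_iff m.Icarr by auto

lemma I_ideal: "ideal I Q"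
  by (rule ring_hom_ring.kernel_is_ideal) (unfold_locales, simp add: phi.homh)

lemma In_ideal: "ideal In Q"
  by (rule Q.ideal_prod_is_ideal[OF I_ideal n.is_ideal])

lemma In_mem: "x \<in> I \<Longrightarrow> y \<in> n \<Longrightarrow> x \<otimes>\<^bsub>Q\<^esub> y \<in> In" "x \<in> I \<Longrightarrow> y \<in> n \<Longrightarrow> y \<otimes>\<^bsub>Q\<^esub> x \<in> In"
  using ideal_prod.prod[of x I y n Q] n.Icarr by (auto simp: Q.m_comm kernel_iff)

text \<open>The step that relates minimality in a resolution over \<open>R\<close> to the ideal \<open>I n\<close> of \<open>Q\<close>. Suppose that
  \<open>t f = \<Sum> \<mu>\<^sub>i u\<^sub>i\<close> with \<open>\<mu>\<^sub>i \<in> m\<close> and \<open>\<psi> u\<^sub>i = 0\<close>. Lift all coordinates to \<open>Q\<close>, and the values of \<open>\<psi>\<close> on the basis to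
  elements of \<open>n\<close>. The lifted form sends a lift of \<open>u\<^sub>i\<close> into \<open>I\<close>, hence a lift of \<open>\<mu>\<^sub>i u\<^sub>i\<close> into \<open>I n\<close>; two
  lifts of the same vector differ by a vector over \<open>I\<close>, on which the lifted form has values in \<open>I n\<close>,
  because the coefficients of the form lie in \<open>n\<close>. So the lifted form takes a value in \<open>I n\<close> at a lift of \<open>t f\<close>, and
  this value is \<open>t b\<close> modulo \<open>I n\<close>.\<close>
lemma lift_mult_in_In:
  assumes V: "module R V" and S: "finite S" "module_basis R V S"
    and \<psi>: "linear_form R V \<psi>" "\<And>v. v \<in> carrier V \<Longrightarrow> \<psi> v \<in> m"
    and K: "LinearCombinations.submodule R K V" "\<And>u. u \<in> K \<Longrightarrow> \<psi> u = \<zero>\<^bsub>R\<^esub>"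
    and t: "t \<in> n" and f: "f \<in> carrier V" and b: "b \<in> carrier Q" "\<phi> b = \<psi> f"
    and mem: "\<phi> t \<odot>\<^bsub>V\<^esub> f \<in> ideal_smult R m (V\<lparr>carrier := K\<rparr>)"
  shows "t \<otimes>\<^bsub>Q\<^esub> b \<in> In"
proof -
  interpret V: module R V by (rule V)
  interpret In: ideal In Q by (rule In_ideal)
  have S': "S \<subseteq> carrier V" "V.lin_indpt S" "V.span S = carrier V"
    using S(2) by (auto simp: module_basis_def)
  have "\<forall>e\<in>S. \<exists>x\<in>n. \<phi> x = \<psi> e" using lift_m \<psi>(2) S'(1) by blast
  then obtain p where p: "\<And>e. e \<in> S \<Longrightarrow> p e \<in> n" "\<And>e. e \<in> S \<Longrightarrow> \<phi> (p e) = \<psi> e" by metis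
  have pc: "e \<in> S \<Longrightarrow> p e \<in> carrier Q" for e using p(1) n.Icarr by auto
  \<comment> \<open>The lifted form \<open>T\<close>; and \<open>L w z\<close> says that \<open>z\<close> is its value at some lift of \<open>w\<close>.\<close>
  define T where "T a = (\<Oplus>\<^bsub>Q\<^esub>e\<in>S. p e \<otimes>\<^bsub>Q\<^esub> a e)" for a
  define L where "L w z \<longleftrightarrow> (\<exists>a \<in> S \<rightarrow> carrier Q. w = V.lincomb (\<lambda>e. \<phi> (a e)) S \<and> z = T a)" for w z
  have Tc: "T a \<in> carrier Q" if "a \<in> S \<rightarrow> carrier Q" for a
    unfolding T_def using that pc by (intro Q.finsum_closed) (auto simp: Pi_iff)
  have L_total: "\<exists>z. L w z" if w: "w \<in> carrier V" for w
  proof -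
    obtain a where a: "a \<in> S \<rightarrow> carrier R" "V.lincomb a S = w"
      using V.finite_in_span[OF S(1) S'(1)] w S'(3) by auto
    have "\<forall>e\<in>S. \<exists>x\<in>carrier Q. \<phi> x = a e" using surj a(1) by (auto simp: Pi_iff)
    then obtain a' where a': "\<And>e. e \<in> S \<Longrightarrow> a' e \<in> carrier Q" "\<And>e. e \<in> S \<Longrightarrow> \<phi> (a' e) = a e"
      by metis
    have "V.lincomb (\<lambda>e. \<phi> (a' e)) S = V.lincomb a S"
      by (rule V.lincomb_cong) (use a' a S' in auto)
    then show ?thesis unfolding L_def using a' a(2) by (intro exI[of _ "T a'"] bexI[of _ a']) auto
  qed
  have L_add: "L (w \<oplus>\<^bsub>V\<^esub> w') (z \<oplus>\<^bsub>Q\<^esub> z')" if "L w z" "L w' z'" for w z w' z'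
  proof -
    from that obtain a a' where a: "a \<in> S \<rightarrow> carrier Q" "w = V.lincomb (\<lambda>e. \<phi> (a e)) S" "z = T a"
      and a': "a' \<in> S \<rightarrow> carrier Q" "w' = V.lincomb (\<lambda>e. \<phi> (a' e)) S" "z' = T a'"
      unfolding L_def by blast
    have aa: "(\<lambda>e. a e \<oplus>\<^bsub>Q\<^esub> a' e) \<in> S \<rightarrow> carrier Q" using a(1) a'(1) by (auto simp: Pi_iff)
    have "w \<oplus>\<^bsub>V\<^esub> w' = V.lincomb (\<lambda>e. \<phi> (a e) \<oplus>\<^bsub>R\<^esub> \<phi> (a' e)) S"
      unfolding a a' by (rule V.lincomb_sum[symmetric]) (use S S' a(1) a'(1) in \<open>auto simp: Pi_iff\<close>)
    also have "\<dots> = V.lincomb (\<lambda>e. \<phi> (a e \<oplus>\<^bsub>Q\<^esub> a' e)) S"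
      by (rule V.lincomb_cong) (use S S' a(1) a'(1) in \<open>auto simp: Pi_iff\<close>)
    finally have w: "w \<oplus>\<^bsub>V\<^esub> w' = V.lincomb (\<lambda>e. \<phi> (a e \<oplus>\<^bsub>Q\<^esub> a' e)) S" .
    have "T (\<lambda>e. a e \<oplus>\<^bsub>Q\<^esub> a' e) = (\<Oplus>\<^bsub>Q\<^esub>e\<in>S. p e \<otimes>\<^bsub>Q\<^esub> a e \<oplus>\<^bsub>Q\<^esub> p e \<otimes>\<^bsub>Q\<^esub> a' e)"
      unfolding T_def using a(1) a'(1) pc by (intro Q.finsum_cong') (auto simp: Pi_iff Q.r_distr)
    also have "\<dots> = z \<oplus>\<^bsub>Q\<^esub> z'"
      unfolding a a' T_def using a(1) a'(1) pc by (intro Q.finsum_addf) (auto simp: Pi_iff)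
    finally show ?thesis unfolding L_def using w aa by metis
  qed
  have L_smult: "L (\<phi> r \<odot>\<^bsub>V\<^esub> w) (r \<otimes>\<^bsub>Q\<^esub> z)" if r: "r \<in> carrier Q" and Lw: "L w z" for r w z
  proof -
    from Lw obtain a where a: "a \<in> S \<rightarrow> carrier Q" "w = V.lincomb (\<lambda>e. \<phi> (a e)) S" "z = T a"
      unfolding L_def by blast
    have ra: "(\<lambda>e. r \<otimes>\<^bsub>Q\<^esub> a e) \<in> S \<rightarrow> carrier Q" using a(1) r by (auto simp: Pi_iff)
    have "\<phi> r \<odot>\<^bsub>V\<^esub> w = V.lincomb (\<lambda>e. \<phi> r \<otimes>\<^bsub>R\<^esub> \<phi> (a e)) S"
      unfolding a by (rule V.lincomb_smult[symmetric]) (use S S' a(1) r in \<open>auto simp: Pi_iff\<close>)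
    also have "\<dots> = V.lincomb (\<lambda>e. \<phi> (r \<otimes>\<^bsub>Q\<^esub> a e)) S"
      by (rule V.lincomb_cong) (use S S' a(1) r in \<open>auto simp: Pi_iff\<close>)
    finally have w: "\<phi> r \<odot>\<^bsub>V\<^esub> w = V.lincomb (\<lambda>e. \<phi> (r \<otimes>\<^bsub>Q\<^esub> a e)) S" .
    have "T (\<lambda>e. r \<otimes>\<^bsub>Q\<^esub> a e) = (\<Oplus>\<^bsub>Q\<^esub>e\<in>S. r \<otimes>\<^bsub>Q\<^esub> (p e \<otimes>\<^bsub>Q\<^esub> a e))"
      unfolding T_def using a(1) r pc by (intro Q.finsum_cong') (auto simp: Pi_iff Q.m_lcomm)
    also have "\<dots> = r \<otimes>\<^bsub>Q\<^esub> z"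
      unfolding a T_def using a(1) r pc S(1) by (intro Q.finsum_rdistr[symmetric]) (auto simp: Pi_iff)
    finally show ?thesis unfolding L_def using w ra by metis
  qed
  have L_eval: "z \<in> carrier Q \<and> w \<in> carrier V \<and> \<phi> z = \<psi> w" if Lw: "L w z" for w z
  proof -
    from Lw obtain a where a: "a \<in> S \<rightarrow> carrier Q" "w = V.lincomb (\<lambda>e. \<phi> (a e)) S" "z = T a"
      unfolding L_def by blast
    have \<phi>a: "(\<lambda>e. \<phi> (a e)) \<in> S \<rightarrow> carrier R" using a(1) by (auto simp: Pi_iff)
    have \<psi>c: "e \<in> S \<Longrightarrow> \<psi> e \<in> carrier R" for e using linear_formD(1)[OF \<psi>(1)] S' by blast
    have "\<phi> z = (\<Oplus>\<^bsub>R\<^esub>e\<in>S. (\<phi> \<circ> (\<lambda>e. p e \<otimes>\<^bsub>Q\<^esub> a e)) e)"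
      unfolding a T_def by (rule phi.hom_finsum) (use a(1) pc in \<open>auto simp: Pi_iff\<close>)
    also have "\<dots> = (\<Oplus>\<^bsub>R\<^esub>e\<in>S. \<phi> (a e) \<otimes>\<^bsub>R\<^esub> \<psi> e)"
      by (rule R.finsum_cong') (use a(1) pc p(2) \<psi>c in \<open>auto simp: Pi_iff R.m_comm\<close>)
    also have "\<dots> = \<psi> w"
      unfolding a by (rule V.linear_form_lincomb[symmetric]) (use \<psi> S' \<phi>a in auto)
    finally show ?thesis using Tc a V.lincomb_closed[OF S'(1) \<phi>a] by blast
  qed
  have L_zero: "z \<in> In" if Lz: "L \<zero>\<^bsub>V\<^esub> z" for z
  proof -
    from Lz obtain a where a: "a \<in> S \<rightarrow> carrier Q" "V.lincomb (\<lambda>e. \<phi> (a e)) S = \<zero>\<^bsub>V\<^esub>" "z = T a"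
      unfolding L_def by metis
    have \<phi>a: "(\<lambda>e. \<phi> (a e)) \<in> S \<rightarrow> carrier R" using a(1) by (auto simp: Pi_iff)
    have "\<phi> (a e) = \<zero>\<^bsub>R\<^esub>" if "e \<in> S" for e
      using V.lin_dep_crit[OF S(1) subset_refl \<phi>a that _ a(2)] S'(2) by blast
    then have aI: "e \<in> S \<Longrightarrow> p e \<otimes>\<^bsub>Q\<^esub> a e \<in> In" for e
      using a(1) p(1) by (intro In_mem(2)) (auto simp: kernel_iff Pi_iff)
    have "(\<Oplus>\<^bsub>Q\<^esub>e\<in>A. p e \<otimes>\<^bsub>Q\<^esub> a e) \<in> In" if "A \<subseteq> S" for A
      using finite_subset[OF that S(1)] that
    proof (induct A rule: finite_induct)
      case (insert e A)
      have "(\<lambda>e. p e \<otimes>\<^bsub>Q\<^esub> a e) \<in> A \<rightarrow> carrier Q" "p e \<otimes>\<^bsub>Q\<^esub> a e \<in> carrier Q"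
        using insert.prems aI In.Icarr by blast+
      then show ?case using insert aI by simp
    qed simp
    then show ?thesis unfolding a T_def by simp
  qed
  let ?W = "V\<lparr>carrier := K\<rparr>"
  \<comment> \<open>All of \<open>m K\<close> admits lifts with value in \<open>I n\<close>: these vectors form a submodule.\<close>
  let ?P = "{w \<in> K. \<exists>z\<in>In. L w z}"
  interpret K: LinearCombinations.submodule R K V by (rule K(1))
  have W: "module R ?W" by (rule V.submodule_is_module[OF K(1)])
  have "LinearCombinations.submodule R ?P ?W"
  proof (rule submodule_intro[OF W])
    obtain z where "L \<zero>\<^bsub>V\<^esub> z" using L_total by blast
    then show "\<zero>\<^bsub>?W\<^esub> \<in> ?P" using L_zero K.zero_closed by auto
    show "v \<oplus>\<^bsub>?W\<^esub> w \<in> ?P" if "v \<in> ?P" "w \<in> ?P" for v w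
      using that L_add K.m_closed In.a_closed by simp blast
    show "r \<odot>\<^bsub>?W\<^esub> v \<in> ?P" if "r \<in> carrier R" "v \<in> ?P" for r v
    proof -
      obtain r' where "r' \<in> carrier Q" "\<phi> r' = r" using surj \<open>r \<in> carrier R\<close> by blast
      then show ?thesis using that L_smult In.I_l_closed K.smult_closed by simp blast
    qed
  qed auto
  moreover have "a \<odot>\<^bsub>?W\<^esub> x \<in> ?P" if ax: "a \<in> m" "x \<in> carrier ?W" for a x
  proof -
    have x: "x \<in> K" "x \<in> carrier V" using ax K.subset by auto
    obtain a' where a': "a' \<in> n" "\<phi> a' = a" using lift_m ax by blast
    obtain z where z: "L x z" using L_total x by blast
    have "z \<in> I" using L_eval[OF z] K(2) x by (simp add: kernel_iff)
    then have "a' \<otimes>\<^bsub>Q\<^esub> z \<in> In" by (intro In_mem a')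
    moreover have "L (a \<odot>\<^bsub>V\<^esub> x) (a' \<otimes>\<^bsub>Q\<^esub> z)" using L_smult[OF _ z, of a'] a' n.Icarr by simp
    ultimately show ?thesis using x ax m.Icarr K.smult_closed by auto
  qed
  ultimately have "ideal_smult R m ?W \<subseteq> ?P" by (rule ideal_smult_subset)
  then obtain z where z: "z \<in> In" "L (\<phi> t \<odot>\<^bsub>V\<^esub> f) z" using mem by blast
  obtain y where y: "L f y" using L_total f by blast
  have yc: "y \<in> carrier Q" "\<phi> y = \<psi> f" using L_eval[OF y] by auto
  have tc: "t \<in> carrier Q" using t n.Icarr by auto
  have zc: "z \<in> carrier Q" using z In.Icarr by auto
  \<comment> \<open>Two lifts of \<open>t f\<close> are compared: the one in \<open>I n\<close> and \<open>t\<close> times a lift of \<open>f\<close>.\<close>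
  have "L (\<phi> t \<odot>\<^bsub>V\<^esub> f \<oplus>\<^bsub>V\<^esub> \<phi> (\<ominus>\<^bsub>Q\<^esub> \<one>\<^bsub>Q\<^esub>) \<odot>\<^bsub>V\<^esub> (\<phi> t \<odot>\<^bsub>V\<^esub> f)) (t \<otimes>\<^bsub>Q\<^esub> y \<oplus>\<^bsub>Q\<^esub> (\<ominus>\<^bsub>Q\<^esub> \<one>\<^bsub>Q\<^esub>) \<otimes>\<^bsub>Q\<^esub> z)"
    by (intro L_add L_smult y z(2) tc) auto
  moreover have "\<phi> t \<odot>\<^bsub>V\<^esub> f \<oplus>\<^bsub>V\<^esub> \<phi> (\<ominus>\<^bsub>Q\<^esub> \<one>\<^bsub>Q\<^esub>) \<odot>\<^bsub>V\<^esub> (\<phi> t \<odot>\<^bsub>V\<^esub> f) = \<zero>\<^bsub>V\<^esub>"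
    using tc f by (simp add: V.smult_l_minus V.M.r_neg)
  ultimately have "t \<otimes>\<^bsub>Q\<^esub> y \<oplus>\<^bsub>Q\<^esub> (\<ominus>\<^bsub>Q\<^esub> \<one>\<^bsub>Q\<^esub>) \<otimes>\<^bsub>Q\<^esub> z \<in> In" using L_zero by simp
  then have "(t \<otimes>\<^bsub>Q\<^esub> y \<oplus>\<^bsub>Q\<^esub> (\<ominus>\<^bsub>Q\<^esub> \<one>\<^bsub>Q\<^esub>) \<otimes>\<^bsub>Q\<^esub> z) \<oplus>\<^bsub>Q\<^esub> z \<in> In" using z(1) by blast
  then have ty: "t \<otimes>\<^bsub>Q\<^esub> y \<in> In" using tc yc zc by (simp add: Q.l_minus Q.a_assoc Q.l_neg)
  have "b \<ominus>\<^bsub>Q\<^esub> y \<in> I" using b yc linear_formD(1)[OF \<psi>(1) f]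
    by (simp add: kernel_iff Q.minus_eq R.r_neg)
  then have "t \<otimes>\<^bsub>Q\<^esub> (b \<ominus>\<^bsub>Q\<^esub> y) \<in> In" by (intro In_mem t)
  then have "t \<otimes>\<^bsub>Q\<^esub> y \<oplus>\<^bsub>Q\<^esub> t \<otimes>\<^bsub>Q\<^esub> (b \<ominus>\<^bsub>Q\<^esub> y) \<in> In" using ty by blast
  moreover have "t \<otimes>\<^bsub>Q\<^esub> y \<oplus>\<^bsub>Q\<^esub> t \<otimes>\<^bsub>Q\<^esub> (b \<ominus>\<^bsub>Q\<^esub> y) = t \<otimes>\<^bsub>Q\<^esub> b"
  proof -
    have "y \<oplus>\<^bsub>Q\<^esub> (b \<ominus>\<^bsub>Q\<^esub> y) = b" using b(1) yc(1) by (simp add: Q.minus_eq Q.a_lcomm Q.r_neg)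
    moreover have "t \<otimes>\<^bsub>Q\<^esub> y \<oplus>\<^bsub>Q\<^esub> t \<otimes>\<^bsub>Q\<^esub> (b \<ominus>\<^bsub>Q\<^esub> y) = t \<otimes>\<^bsub>Q\<^esub> (y \<oplus>\<^bsub>Q\<^esub> (b \<ominus>\<^bsub>Q\<^esub> y))"
      using b(1) yc(1) tc by (simp add: Q.r_distr)
    ultimately show ?thesis by simp
  qed
  ultimately show ?thesis by simp
qed

end

section \<open>Independence modulo the Burch ideal\<close>

lemma (in cring) colon_ideal_ideal:
  assumes "ideal I R" "J \<subseteq> carrier R"
  shows "ideal (colon_ideal R I J) R"
proof -
  interpret I: ideal I R by (rule assms(1))
  have J: "y \<in> J \<Longrightarrow> y \<in> carrier R" for y using assms(2) by auto
  show ?thesis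
  proof (rule idealI[OF ring_axioms])
    show "subgroup (colon_ideal R I J) (add_monoid R)"
    proof (rule add.subgroupI)
      show "colon_ideal R I J \<subseteq> carrier R" by (auto simp: colon_ideal_def)
      have "\<zero> \<in> colon_ideal R I J" using J by (simp add: colon_ideal_def)
      then show "colon_ideal R I J \<noteq> {}" by blast
      show "\<ominus> a \<in> colon_ideal R I J" if "a \<in> colon_ideal R I J" for a
        using that J by (auto simp: colon_ideal_def l_minus)
      show "a \<oplus> b \<in> colon_ideal R I J" if "a \<in> colon_ideal R I J" "b \<in> colon_ideal R I J" for a b
        using that J by (auto simp: colon_ideal_def l_distr)
    qed
    show "x \<otimes> a \<in> colon_ideal R I J" if "a \<in> colon_ideal R I J" "x \<in> carrier R" for a x
      using that J by (auto simp: colon_ideal_def m_assoc I.I_l_closed)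
    then show "a \<otimes> x \<in> colon_ideal R I J" if "a \<in> colon_ideal R I J" "x \<in> carrier R" for a x
      using that by (metis (no_types, lifting) colon_ideal_def m_comm mem_Collect_eq)
  qed
qed

text \<open>The coset operation is well defined on \<open>R/n \<times> n/B\<close> because \<open>n n \<subseteq> B\<close>.\<close>
lemma (in cring) ideal_quotient_smult:
  assumes "ideal n R" "ideal B R" "\<And>x y. x \<in> n \<Longrightarrow> y \<in> n \<Longrightarrow> x \<otimes> y \<in> B"
    and a: "a \<in> carrier R" and x: "x \<in> n"
  shows "rcoset_mult R B (n +> a) (B +> x) = B +> (a \<otimes> x)"
proof -
  interpret n: ideal n R by (rule assms(1))
  interpret B: ideal B R by (rule assms(2))
  have xc: "x \<in> carrier R" using x n.Icarr by auto
  have eq: "B +> (a' \<otimes> x') = B +> (a \<otimes> x)" if ax: "a' \<in> n +> a" "x' \<in> B +> x" for a' x'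
  proof -
    from ax obtain \<nu> \<beta> where *: "\<nu> \<in> n" "\<beta> \<in> B" "a' = \<nu> \<oplus> a" "x' = \<beta> \<oplus> x"
      unfolding a_r_coset_def' by auto
    have c: "\<nu> \<in> carrier R" "\<beta> \<in> carrier R" using * n.Icarr B.Icarr by auto
    have "a' \<otimes> x' = (\<nu> \<otimes> \<beta> \<oplus> (\<nu> \<otimes> x \<oplus> a \<otimes> \<beta>)) \<oplus> a \<otimes> x"
      unfolding * using c a xc by (simp add: l_distr r_distr a_ac)
    moreover have "\<nu> \<otimes> \<beta> \<oplus> (\<nu> \<otimes> x \<oplus> a \<otimes> \<beta>) \<in> B"
      by (intro B.a_closed B.I_l_closed[OF *(2)] c a assms(3)[OF *(1) x])
    ultimately have "a' \<otimes> x' \<in> B +> (a \<otimes> x)" unfolding a_r_coset_def' by auto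
    then show ?thesis using B.a_repr_independence'[of "a' \<otimes> x'" "a \<otimes> x"] a xc by simp
  qed
  have "a \<in> n +> a" "x \<in> B +> x" using n.a_rcos_self[OF a] B.a_rcos_self[OF xc] by auto
  then show ?thesis unfolding rcoset_mult_def using eq by blast
qed

lemma (in cring) ideal_quotient_vectorspace:
  assumes n: "maximalideal n R" and B: "ideal B R"
    and nn: "\<And>x y. x \<in> n \<Longrightarrow> y \<in> n \<Longrightarrow> x \<otimes> y \<in> B"
  shows "vectorspace (R Quot n) (ideal_quotient_space R n B)"
proof -
  interpret n: maximalideal n R by (rule n)
  interpret B: ideal B R by (rule B)
  let ?K = "R Quot n" and ?V = "ideal_quotient_space R n B"
  have K: "field ?K" by (rule n.quotient_is_field[OF is_cring])
  then interpret K: field ?K .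
  have nc: "x \<in> n \<Longrightarrow> x \<in> carrier R" for x using n.Icarr by auto
  have cV: "carrier ?V = (\<lambda>x. B +> x) ` n" and zV: "\<zero>\<^bsub>?V\<^esub> = B +> \<zero>"
    using B.a_subset by (simp_all add: ideal_quotient_space_def)
  have aV: "(B +> x) \<oplus>\<^bsub>?V\<^esub> (B +> y) = B +> (x \<oplus> y)" if "x \<in> n" "y \<in> n" for x y
    using that nc by (simp add: ideal_quotient_space_def B.a_rcos_sum)
  have sV: "(n +> a) \<odot>\<^bsub>?V\<^esub> (B +> x) = B +> (a \<otimes> x)" if "a \<in> carrier R" "x \<in> n" for a x
    using that by (simp add: ideal_quotient_space_def ideal_quotient_smult[OF n.is_ideal B nn])
  have cK: "carrier ?K = (\<lambda>a. n +> a) ` carrier R"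
    by (auto simp: FactRing_def A_RCOSETS_def')
  have aK: "(n +> a) \<oplus>\<^bsub>?K\<^esub> (n +> b) = n +> (a \<oplus> b)" if "a \<in> carrier R" "b \<in> carrier R" for a b
    using that by (simp add: FactRing_def n.a_rcos_sum)
  have mK: "(n +> a) \<otimes>\<^bsub>?K\<^esub> (n +> b) = n +> (a \<otimes> b)" if "a \<in> carrier R" "b \<in> carrier R" for a b
    using that by (simp add: FactRing_def n.rcoset_mult_add)
  have oK: "\<one>\<^bsub>?K\<^esub> = n +> \<one>" by (simp add: FactRing_def)
  have "module ?K ?V"
  proof (rule module_criteria)
    show "cring ?K" by (rule K.is_cring)
    show "\<zero>\<^bsub>?V\<^esub> \<in> carrier ?V" unfolding cV zV using n.zero_closed by blast
    show "\<forall>v w. v \<in> carrier ?V \<and> w \<in> carrier ?V \<longrightarrow> v \<oplus>\<^bsub>?V\<^esub> w \<in> carrier ?V"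
      unfolding cV by (auto simp: aV)
    show "\<forall>v\<in>carrier ?V. \<exists>neg_v\<in>carrier ?V. v \<oplus>\<^bsub>?V\<^esub> neg_v = \<zero>\<^bsub>?V\<^esub>"
    proof
      fix v assume "v \<in> carrier ?V"
      then obtain x where x: "x \<in> n" "v = B +> x" unfolding cV by auto
      then have "v \<oplus>\<^bsub>?V\<^esub> (B +> (\<ominus> x)) = \<zero>\<^bsub>?V\<^esub>" using nc by (simp add: aV zV r_neg)
      then show "\<exists>neg_v\<in>carrier ?V. v \<oplus>\<^bsub>?V\<^esub> neg_v = \<zero>\<^bsub>?V\<^esub>" unfolding cV using x by auto
    qed
    show "\<forall>c v. c \<in> carrier ?K \<and> v \<in> carrier ?V \<longrightarrow> c \<odot>\<^bsub>?V\<^esub> v \<in> carrier ?V"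
      unfolding cV cK by (auto simp: sV n.I_l_closed)
    show "\<forall>v w. v \<in> carrier ?V \<and> w \<in> carrier ?V \<longrightarrow> v \<oplus>\<^bsub>?V\<^esub> w = w \<oplus>\<^bsub>?V\<^esub> v"
      unfolding cV by (auto simp: aV nc a_comm)
    show "\<forall>v w x. v \<in> carrier ?V \<and> w \<in> carrier ?V \<and> x \<in> carrier ?V \<longrightarrow>
        v \<oplus>\<^bsub>?V\<^esub> w \<oplus>\<^bsub>?V\<^esub> x = v \<oplus>\<^bsub>?V\<^esub> (w \<oplus>\<^bsub>?V\<^esub> x)"
      unfolding cV by (auto simp: aV nc a_assoc)
    show "\<forall>v\<in>carrier ?V. v \<oplus>\<^bsub>?V\<^esub> \<zero>\<^bsub>?V\<^esub> = v"
      unfolding cV zV by (auto simp: aV nc)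
    show "\<forall>a b v. a \<in> carrier ?K \<and> b \<in> carrier ?K \<and> v \<in> carrier ?V \<longrightarrow>
        (a \<otimes>\<^bsub>?K\<^esub> b) \<odot>\<^bsub>?V\<^esub> v = a \<odot>\<^bsub>?V\<^esub> (b \<odot>\<^bsub>?V\<^esub> v)"
      unfolding cV cK by (auto simp: sV mK nc m_assoc n.I_l_closed)
    show "\<forall>v\<in>carrier ?V. \<one>\<^bsub>?K\<^esub> \<odot>\<^bsub>?V\<^esub> v = v"
      unfolding cV oK by (auto simp: sV nc)
    show "\<forall>a b v. a \<in> carrier ?K \<and> b \<in> carrier ?K \<and> v \<in> carrier ?V \<longrightarrow>
        (a \<oplus>\<^bsub>?K\<^esub> b) \<odot>\<^bsub>?V\<^esub> v = a \<odot>\<^bsub>?V\<^esub> v \<oplus>\<^bsub>?V\<^esub> b \<odot>\<^bsub>?V\<^esub> v"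
      unfolding cV cK by (auto simp: sV aK aV nc l_distr n.I_l_closed)
    show "\<forall>a v w. a \<in> carrier ?K \<and> v \<in> carrier ?V \<and> w \<in> carrier ?V \<longrightarrow>
        a \<odot>\<^bsub>?V\<^esub> (v \<oplus>\<^bsub>?V\<^esub> w) = a \<odot>\<^bsub>?V\<^esub> v \<oplus>\<^bsub>?V\<^esub> a \<odot>\<^bsub>?V\<^esub> w"
      unfolding cV cK by (auto simp: sV aV nc r_distr n.I_l_closed)
  qed
  then show ?thesis using K by (simp add: vectorspace_def)
qed

lemma (in vectorspace) dim_less_if_generated:
  assumes "finite A" "A \<subseteq> carrier V" "gen_set A" "card A < d"
  shows "dim < d"
proof -
  have "dim \<le> card A" unfolding dim_def by (rule Least_le) (use assms in blast)
  then show ?thesis using assms(4) by simp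
qed

text \<open>Two elements of \<open>n\<close> that are linearly independent modulo \<open>B\<close>; otherwise \<open>n/B\<close> would be spanned by
  the empty set or by one coset.\<close>
lemma (in cring) ideal_quotient_two_independent:
  assumes n: "maximalideal n R" and B: "ideal B R"
    and nn: "\<And>x y. x \<in> n \<Longrightarrow> y \<in> n \<Longrightarrow> x \<otimes> y \<in> B"
    and dim: "vectorspace.dim (R Quot n) (ideal_quotient_space R n B) \<ge> 2"
  obtains x y where "x \<in> n" "x \<notin> B" "y \<in> n" "\<And>r. r \<in> carrier R \<Longrightarrow> y \<ominus> r \<otimes> x \<notin> B"
proof -
  interpret n: maximalideal n R by (rule n)
  interpret B: ideal B R by (rule B)
  let ?K = "R Quot n" and ?V = "ideal_quotient_space R n B"
  interpret V: vectorspace ?K ?V by (rule ideal_quotient_vectorspace[OF n B nn])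
  have nc: "x \<in> n \<Longrightarrow> x \<in> carrier R" for x using n.Icarr by auto
  have cV: "carrier ?V = (\<lambda>x. B +> x) ` n" by (simp add: ideal_quotient_space_def)
  have "\<not> n \<subseteq> B"
  proof
    assume nB: "n \<subseteq> B"
    have "B +> x = B" if "x \<in> n" for x
      using a_coset_join2[OF nc[OF that] B.a_subgroup] nB that by blast
    then have "carrier ?V \<subseteq> {\<zero>\<^bsub>?V\<^esub>}" unfolding cV by (auto simp: ideal_quotient_space_def)
    moreover have "\<zero>\<^bsub>?V\<^esub> \<in> V.span {}"
      using submodule.zero_closed[OF V.span_is_submodule[of "{}"]] by simp
    ultimately have "V.gen_set {}" using V.span_is_subset2[of "{}"] by blast
    from V.dim_less_if_generated[OF _ _ this, of 2] dim show False by simp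
  qed
  then obtain x where x: "x \<in> n" "x \<notin> B" by blast
  have "\<exists>y\<in>n. \<forall>r\<in>carrier R. y \<ominus> r \<otimes> x \<notin> B"
  proof (rule ccontr)
    assume *: "\<not> ?thesis"
    let ?X = "B +> x"
    have Xc: "{?X} \<subseteq> carrier ?V" unfolding cV using x by blast
    have "v \<in> V.span {?X}" if v: "v \<in> carrier ?V" for v
    proof -
      from v obtain y where y: "y \<in> n" "v = B +> y" unfolding cV by auto
      then obtain r where r: "r \<in> carrier R" "y \<ominus> r \<otimes> x \<in> B" using * by blast
      then have "y \<in> B +> (r \<otimes> x)"
        using B.a_rcos_module_minus[OF ring_axioms, of "r \<otimes> x" y] nc x y by simp
      then have "v = B +> (r \<otimes> x)"
        using B.a_repr_independence'[of y "r \<otimes> x"] y r x nc by simp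
      also have "\<dots> = (n +> r) \<odot>\<^bsub>?V\<^esub> ?X"
        using ideal_quotient_smult[OF n.is_ideal B nn r(1) x(1)] by (simp add: ideal_quotient_space_def)
      finally have "v = (n +> r) \<odot>\<^bsub>?V\<^esub> ?X" .
      moreover have "n +> r \<in> carrier ?K" using r by (auto simp: FactRing_def A_RCOSETS_def')
      moreover have "?X \<in> V.span {?X}" using V.in_own_span[OF Xc] by simp
      ultimately show ?thesis using submodule.smult_closed[OF V.span_is_submodule[OF Xc]] by simp
    qed
    then have "V.gen_set {?X}" using V.span_is_subset2[OF Xc] by blast
    from V.dim_less_if_generated[OF _ Xc this, of 2] dim show False by simp
  qed
  then show ?thesis using that x by blast
qed

section \<open>Maximality of the graded maximal ideal\<close>

lemma (in additive_subgroup) finsum_mem: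
  assumes "abelian_group G" "\<And>i. i \<in> A \<Longrightarrow> f i \<in> H"
  shows "finsum G f A \<in> H"
proof -
  interpret G: abelian_group G by (rule assms(1))
  show ?thesis using assms(2)
  proof (induct A rule: infinite_finite_induct)
    case (insert i A)
    then have "f \<in> A \<rightarrow> carrier G" "f i \<in> carrier G" using a_subset by blast+
    then show ?case using insert by auto
  qed simp_all
qed

text \<open>The elements without component in degree \<open>0\<close> form an ideal, since in \<open>\<nat>\<^sup>l\<close> a sum of degrees is
  \<open>0\<close> only if both are. It contains \<open>m\<close>, and it does not contain \<open>1\<close>, so \<open>m\<close> is proper. Conversely
  an element outside \<open>m\<close> is congruent modulo \<open>m\<close> to its component in degree \<open>0\<close>, which is a nonzero
  element of a field.\<close>
lemma graded_local_ring_maximalideal: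
  fixes R :: "('a, 'b) ring_scheme" and G :: "('l::finite \<Rightarrow> nat) \<Rightarrow> 'a set"
  assumes "graded_local_ring R G m"
  shows "maximalideal m R"
proof -
  have R: "cring R" and dec: "direct_sum_decomposition R G" and one: "\<one>\<^bsub>R\<^esub> \<in> G (\<lambda>_. 0)"
    and mult: "\<And>d e x y. x \<in> G d \<Longrightarrow> y \<in> G e \<Longrightarrow> x \<otimes>\<^bsub>R\<^esub> y \<in> G (\<lambda>i. d i + e i)"
    and fld: "field (R\<lparr>carrier := G (\<lambda>_. 0)\<rparr>)"
    and m: "m = Idl\<^bsub>R\<^esub> (\<Union>d \<in> {d. d \<noteq> (\<lambda>_. 0)}. G d)"
    using assms by (auto simp: graded_local_ring_def graded_ring_def)
  interpret R: cring R by (rule R)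
  let ?o = "\<lambda>_. 0 :: nat"
  let ?U = "\<Union>d \<in> {d. d \<noteq> ?o}. G d"
  have G: "additive_subgroup (G d) R" for d using dec by (auto simp: direct_sum_decomposition_def)
  have Gc: "G d \<subseteq> carrier R" for d by (rule additive_subgroup.a_subset[OF G])
  \<comment> \<open>\<open>f\<close> is the family of homogeneous components of \<open>x\<close>.\<close>
  define comps where "comps x f \<longleftrightarrow> (\<forall>d. f d \<in> G d) \<and> finite {d. f d \<noteq> \<zero>\<^bsub>R\<^esub>} \<and>
      x = finsum R f {d. f d \<noteq> \<zero>\<^bsub>R\<^esub>}" for x f
  have ex: "\<exists>f. comps x f" and uniq: "comps x f \<Longrightarrow> comps x g \<Longrightarrow> f = g" if "x \<in> carrier R" for x f g
    using dec that unfolding direct_sum_decomposition_def comps_def by (blast, blast)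
  have ext: "x = finsum R f A" if "comps x f" "finite A" "{d. f d \<noteq> \<zero>\<^bsub>R\<^esub>} \<subseteq> A" for x f A
  proof -
    have "f \<in> A \<rightarrow> carrier R" using that(1) Gc by (auto simp: comps_def)
    then have "finsum R f {d. f d \<noteq> \<zero>\<^bsub>R\<^esub>} = finsum R f A"
      using that(2,3) by (intro R.add.finprod_mono_neutral_cong_left) auto
    then show ?thesis using that(1) by (simp add: comps_def)
  qed
  have compsI: "comps (finsum R f A) f" if "finite A" "\<And>d. f d \<in> G d" "{d. f d \<noteq> \<zero>\<^bsub>R\<^esub>} \<subseteq> A" for f A
  proof -
    have "f \<in> A \<rightarrow> carrier R" using that(2) Gc by auto
    then have "finsum R f {d. f d \<noteq> \<zero>\<^bsub>R\<^esub>} = finsum R f A"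
      using that by (intro R.add.finprod_mono_neutral_cong_left) auto
    then show ?thesis using that by (auto simp: comps_def intro: finite_subset)
  qed
  have single: "comps x (\<lambda>d'. if d' = d then x else \<zero>\<^bsub>R\<^esub>)" if x: "x \<in> G d" for x d
  proof -
    have "x \<in> carrier R" using x Gc by blast
    then have "finsum R (\<lambda>d'. if d' = d then x else \<zero>\<^bsub>R\<^esub>) {d} = x"
      using R.finsum_insert[of "{}" d "\<lambda>d'. if d' = d then x else \<zero>\<^bsub>R\<^esub>"] by simp
    moreover have "comps (finsum R (\<lambda>d'. if d' = d then x else \<zero>\<^bsub>R\<^esub>) {d}) (\<lambda>d'. if d' = d then x else \<zero>\<^bsub>R\<^esub>)"
    proof (rule compsI)
      show "(if d' = d then x else \<zero>\<^bsub>R\<^esub>) \<in> G d'" for d'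
        using x additive_subgroup.zero_closed[OF G] by (cases "d' = d") simp_all
    qed auto
    ultimately show ?thesis by simp
  qed
  define K where "K = {x \<in> carrier R. \<exists>f. comps x f \<and> f ?o = \<zero>\<^bsub>R\<^esub>}"
  have Kadd: "x \<oplus>\<^bsub>R\<^esub> y \<in> K" if xy: "x \<in> K" "y \<in> K" for x y
  proof -
    obtain f g where f: "comps x f" "f ?o = \<zero>\<^bsub>R\<^esub>" and g: "comps y g" "g ?o = \<zero>\<^bsub>R\<^esub>"
      and c: "x \<in> carrier R" "y \<in> carrier R" using xy unfolding K_def by blast
    let ?A = "{d. f d \<noteq> \<zero>\<^bsub>R\<^esub>} \<union> {d. g d \<noteq> \<zero>\<^bsub>R\<^esub>}"
    have fin: "finite ?A" using f g by (simp add: comps_def)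
    have fgG: "f d \<in> G d" "g d \<in> G d" for d using f g by (auto simp: comps_def)
    then have fgc: "f d \<in> carrier R" "g d \<in> carrier R" for d using Gc by blast+
    have "x \<oplus>\<^bsub>R\<^esub> y = finsum R f ?A \<oplus>\<^bsub>R\<^esub> finsum R g ?A"
      using ext[OF f(1) fin] ext[OF g(1) fin] by auto
    also have "\<dots> = finsum R (\<lambda>d. f d \<oplus>\<^bsub>R\<^esub> g d) ?A"
      using fgc by (intro R.finsum_addf[symmetric]) auto
    finally have "x \<oplus>\<^bsub>R\<^esub> y = finsum R (\<lambda>d. f d \<oplus>\<^bsub>R\<^esub> g d) ?A" .
    moreover have "comps (finsum R (\<lambda>d. f d \<oplus>\<^bsub>R\<^esub> g d) ?A) (\<lambda>d. f d \<oplus>\<^bsub>R\<^esub> g d)"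
      by (rule compsI[OF fin]) (use fgG additive_subgroup.a_closed[OF G] in auto)
    ultimately have "comps (x \<oplus>\<^bsub>R\<^esub> y) (\<lambda>d. f d \<oplus>\<^bsub>R\<^esub> g d)" by simp
    moreover have "f ?o \<oplus>\<^bsub>R\<^esub> g ?o = \<zero>\<^bsub>R\<^esub>" using f g by simp
    ultimately show ?thesis unfolding K_def using c by blast
  qed
  have homK: "x \<in> K" if "x \<in> G d" "d \<noteq> ?o" for x d
    using single[OF that(1)] that Gc unfolding K_def by force
  have K0: "\<zero>\<^bsub>R\<^esub> \<in> K"
    using single[of "\<zero>\<^bsub>R\<^esub>" ?o] additive_subgroup.zero_closed[OF G] unfolding K_def by auto
  have Ksum: "finsum R h A \<in> K" if "finite A" "\<And>i. i \<in> A \<Longrightarrow> h i \<in> K" for h and A :: "('l \<Rightarrow> nat) set"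
    using that
  proof (induct A rule: finite_induct)
    case (insert i A)
    then have "h \<in> A \<rightarrow> carrier R" "h i \<in> carrier R" unfolding K_def by auto
    then show ?case using insert Kadd by simp
  qed (simp add: K0)
  have Kmult: "r \<otimes>\<^bsub>R\<^esub> x \<in> K" if r: "r \<in> carrier R" and x: "x \<in> K" for r x
  proof -
    obtain f where f: "comps x f" "f ?o = \<zero>\<^bsub>R\<^esub>" and xc: "x \<in> carrier R" using x unfolding K_def by blast
    obtain g where g: "comps r g" using ex[OF r] by blast
    let ?A = "{d. f d \<noteq> \<zero>\<^bsub>R\<^esub>}" and ?B = "{d. g d \<noteq> \<zero>\<^bsub>R\<^esub>}"
    have fgG: "f d \<in> G d" "g d \<in> G d" for d using f g by (auto simp: comps_def)
    then have fgc: "f d \<in> carrier R" "g d \<in> carrier R" for d using Gc by blast+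
    have fin: "finite ?A" "finite ?B" using f g by (simp_all add: comps_def)
    have gx: "g e \<otimes>\<^bsub>R\<^esub> x \<in> K" for e
    proof -
      have "g e \<otimes>\<^bsub>R\<^esub> x = finsum R (\<lambda>d. g e \<otimes>\<^bsub>R\<^esub> f d) ?A"
        using f(1) fgc R.finsum_rdistr[OF fin(1), of "g e" f] by (auto simp: comps_def)
      moreover have "finsum R (\<lambda>d. g e \<otimes>\<^bsub>R\<^esub> f d) ?A \<in> K"
      proof (rule Ksum[OF fin(1)])
        fix d assume "d \<in> ?A"
        then have "d \<noteq> ?o" using f(2) by auto
        then have "(\<lambda>i. e i + d i) \<noteq> ?o" by (auto simp: fun_eq_iff)
        then show "g e \<otimes>\<^bsub>R\<^esub> f d \<in> K" using homK[OF mult] fgG by blast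
      qed
      ultimately show ?thesis by simp
    qed
    have "r \<otimes>\<^bsub>R\<^esub> x = finsum R (\<lambda>e. g e \<otimes>\<^bsub>R\<^esub> x) ?B"
      using g fgc R.finsum_ldistr[OF fin(2) xc, of g] by (auto simp: comps_def)
    then show ?thesis using Ksum[OF fin(2)] gx by simp
  qed
  have K_ideal: "ideal K R"
  proof (rule idealI[OF R.ring_axioms])
    show "subgroup K (add_monoid R)"
    proof (rule R.add.subgroupI)
      show "K \<subseteq> carrier R" by (auto simp: K_def)
      show "K \<noteq> {}" using K0 by blast
      show "\<ominus>\<^bsub>R\<^esub> a \<in> K" if "a \<in> K" for a
      proof -
        have "\<ominus>\<^bsub>R\<^esub> a = (\<ominus>\<^bsub>R\<^esub> \<one>\<^bsub>R\<^esub>) \<otimes>\<^bsub>R\<^esub> a" using that by (simp add: R.l_minus K_def)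
        then show ?thesis using Kmult that by simp
      qed
    qed (use Kadd in auto)
    show "x \<otimes>\<^bsub>R\<^esub> a \<in> K" if "a \<in> K" "x \<in> carrier R" for a x using Kmult that by simp
    then show "a \<otimes>\<^bsub>R\<^esub> x \<in> K" if "a \<in> K" "x \<in> carrier R" for a x
      using that R.m_comm[of a x] by (simp add: K_def)
  qed
  have U: "?U \<subseteq> carrier R" using Gc by blast
  have m_ideal: "ideal m R" unfolding m by (rule R.genideal_ideal[OF U])
  then interpret m: ideal m R .
  have Um: "?U \<subseteq> m" unfolding m by (rule R.genideal_self[OF U])
  have mK: "m \<subseteq> K" unfolding m by (rule R.genideal_minimal[OF K_ideal]) (use homK in blast)
  have "\<one>\<^bsub>R\<^esub> \<notin> K"
  proof
    assume "\<one>\<^bsub>R\<^esub> \<in> K"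
    then obtain f where "comps \<one>\<^bsub>R\<^esub> f" "f ?o = \<zero>\<^bsub>R\<^esub>" unfolding K_def by blast
    with uniq[OF R.one_closed this(1) single[OF one]] have "\<one>\<^bsub>R\<^esub> = \<zero>\<^bsub>R\<^esub>" by simp
    then show False using domain.one_not_zero[OF field.axioms(1)[OF fld]] by simp
  qed
  then have one_m: "\<one>\<^bsub>R\<^esub> \<notin> m" using mK by blast
  show ?thesis
  proof (rule maximalidealI[OF m_ideal])
    show "carrier R \<noteq> m" using one_m by auto
    fix J assume J: "ideal J R" "m \<subseteq> J" "J \<subseteq> carrier R"
    interpret J: ideal J R by (rule J(1))
    show "J = m \<or> J = carrier R"
    proof (cases "J \<subseteq> m")
      case True
      then show ?thesis using J(2) by blast
    next
      case False
      then obtain x where x: "x \<in> J" "x \<notin> m" by blast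
      have xc: "x \<in> carrier R" using x J(3) by blast
      obtain f where f: "comps x f" using ex[OF xc] by blast
      have fG: "f d \<in> G d" for d using f by (auto simp: comps_def)
      then have fc: "f d \<in> carrier R" for d using Gc by blast
      let ?A = "{d. f d \<noteq> \<zero>\<^bsub>R\<^esub>} - {?o}"
      have fin: "finite ?A" using f by (simp add: comps_def)
      define t where "t = finsum R f ?A"
      have tm: "t \<in> m"
        unfolding t_def by (rule m.finsum_mem[OF R.abelian_group_axioms]) (use fG Um in blast)
      have tc: "t \<in> carrier R" using tm m.Icarr by blast
      have "x = finsum R f (insert ?o ?A)"
        by (rule ext[OF f]) (use fin in auto)
      also have "\<dots> = f ?o \<oplus>\<^bsub>R\<^esub> t"
        unfolding t_def using fin fc by (intro R.finsum_insert) auto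
      finally have xe: "x = f ?o \<oplus>\<^bsub>R\<^esub> t" .
      have "(f ?o \<oplus>\<^bsub>R\<^esub> t) \<ominus>\<^bsub>R\<^esub> t = f ?o"
        using fc[of ?o] tc by (simp add: R.minus_eq R.a_assoc R.r_neg)
      moreover have "x \<oplus>\<^bsub>R\<^esub> (\<ominus>\<^bsub>R\<^esub> t) \<in> J"
        by (intro J.a_closed J.a_inv_closed x(1) subsetD[OF J(2)] tm)
      ultimately have foJ: "f ?o \<in> J" using xe by (simp add: R.minus_eq)
      have "f ?o \<noteq> \<zero>\<^bsub>R\<^esub>"
      proof
        assume "f ?o = \<zero>\<^bsub>R\<^esub>"
        then have "x = t" using xe tc by simp
        then show False using tm x(2) by simp
      qed
      then have "f ?o \<in> Units (R\<lparr>carrier := G ?o\<rparr>)"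
        using field.field_Units[OF fld] fG by simp
      then obtain g where "g \<in> G ?o" "g \<otimes>\<^bsub>R\<^esub> f ?o = \<one>\<^bsub>R\<^esub>" unfolding Units_def by auto
      then have "\<one>\<^bsub>R\<^esub> \<in> J" using J.I_l_closed[OF foJ, of g] Gc by auto
      then show ?thesis using J.one_imp_carrier by blast
    qed
  qed
qed

section \<open>The Burch ideal\<close>

context local_surjection
begin

lemma BI_eq: "BI = colon_ideal Q In socQ"
  by (simp add: burch_ideal_def Let_def)

lemma BI_ideal: "ideal BI Q"
  unfolding BI_eq by (rule Q.colon_ideal_ideal[OF In_ideal]) (auto simp: colon_ideal_def)

text \<open>If \<open>s n \<subseteq> I\<close>, then \<open>x y s = x (s y) \<in> n I\<close>.\<close>
lemma n_square_in_BI: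
  assumes "x \<in> n" "y \<in> n"
  shows "x \<otimes>\<^bsub>Q\<^esub> y \<in> BI"
proof -
  have c: "x \<in> carrier Q" "y \<in> carrier Q" using assms n.Icarr by auto
  have "(x \<otimes>\<^bsub>Q\<^esub> y) \<otimes>\<^bsub>Q\<^esub> s \<in> In" if s: "s \<in> socQ" for s
  proof -
    have sc: "s \<in> carrier Q" and sy: "s \<otimes>\<^bsub>Q\<^esub> y \<in> I" using s assms unfolding colon_ideal_def by blast+
    have "x \<otimes>\<^bsub>Q\<^esub> (s \<otimes>\<^bsub>Q\<^esub> y) \<in> In" by (rule In_mem(2)[OF sy assms(1)])
    then show ?thesis using c sc by (simp add: Q.m_ac)
  qed
  then show ?thesis unfolding BI_eq using c by (simp add: colon_ideal_def)
qed

lemma not_BI: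
  assumes "b \<in> carrier Q" "b \<notin> BI"
  obtains s where "s \<in> carrier Q" "\<And>x. x \<in> n \<Longrightarrow> s \<otimes>\<^bsub>Q\<^esub> x \<in> I" "s \<otimes>\<^bsub>Q\<^esub> b \<notin> In"
proof -
  obtain s where s: "s \<in> socQ" "b \<otimes>\<^bsub>Q\<^esub> s \<notin> In" using assms unfolding BI_eq colon_ideal_def[of Q In] by blast
  then have "s \<in> carrier Q" "\<And>x. x \<in> n \<Longrightarrow> s \<otimes>\<^bsub>Q\<^esub> x \<in> I" unfolding colon_ideal_def by blast+
  moreover have "s \<otimes>\<^bsub>Q\<^esub> b \<notin> In" using s(2) assms(1) calculation(1) by (simp add: Q.m_comm)
  ultimately show ?thesis using that by blast
qed

text \<open>The form in which Burch index at least two enters: the vector \<open>(y, -x)\<close> pairs with a vector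
  \<open>(a, b)\<close> having \<open>a \<notin> n\<close> to an element outside the Burch ideal. Otherwise, after multiplying by an
  inverse of \<open>a\<close> modulo \<open>n\<close>, \<open>y\<close> would be congruent to a multiple of \<open>x\<close>, since \<open>n\<^sup>2\<close> lies in the Burch
  ideal.\<close>
lemma independent_pair:
  assumes "burch_index Q n R \<phi> \<ge> 2"
  obtains x y where "x \<in> n" "x \<notin> BI" "y \<in> n"
    "\<And>a b. a \<in> carrier Q \<Longrightarrow> b \<in> carrier Q \<Longrightarrow> a \<notin> n \<Longrightarrow> y \<otimes>\<^bsub>Q\<^esub> a \<ominus>\<^bsub>Q\<^esub> x \<otimes>\<^bsub>Q\<^esub> b \<notin> BI"
proof -
  interpret BI: ideal BI Q by (rule BI_ideal)
  obtain x y where xy: "x \<in> n" "x \<notin> BI" "y \<in> n" "\<And>r. r \<in> carrier Q \<Longrightarrow> y \<ominus>\<^bsub>Q\<^esub> r \<otimes>\<^bsub>Q\<^esub> x \<notin> BI"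
    using Q.ideal_quotient_two_independent[OF n.is_maximalideal BI_ideal n_square_in_BI] assms
    unfolding burch_index_def by metis
  have c: "x \<in> carrier Q" "y \<in> carrier Q" using xy n.Icarr by auto
  have "y \<otimes>\<^bsub>Q\<^esub> a \<ominus>\<^bsub>Q\<^esub> x \<otimes>\<^bsub>Q\<^esub> b \<notin> BI" if ab: "a \<in> carrier Q" "b \<in> carrier Q" "a \<notin> n" for a b
  proof
    assume mem: "y \<otimes>\<^bsub>Q\<^esub> a \<ominus>\<^bsub>Q\<^esub> x \<otimes>\<^bsub>Q\<^esub> b \<in> BI"
    obtain a' \<nu> where a': "a' \<in> carrier Q" "\<nu> \<in> n" "a' \<otimes>\<^bsub>Q\<^esub> a \<oplus>\<^bsub>Q\<^esub> \<nu> = \<one>\<^bsub>Q\<^esub>"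
      using Q.maximalideal_inverse[OF n.is_maximalideal ab(1,3)] by metis
    have \<nu>: "\<nu> \<in> carrier Q" using a' n.Icarr by auto
    have "a' \<otimes>\<^bsub>Q\<^esub> (y \<otimes>\<^bsub>Q\<^esub> a \<ominus>\<^bsub>Q\<^esub> x \<otimes>\<^bsub>Q\<^esub> b) \<oplus>\<^bsub>Q\<^esub> \<nu> \<otimes>\<^bsub>Q\<^esub> y \<in> BI"
      by (intro BI.a_closed BI.I_l_closed mem a'(1) n_square_in_BI a'(2) xy(3))
    moreover have "a' \<otimes>\<^bsub>Q\<^esub> (y \<otimes>\<^bsub>Q\<^esub> a \<ominus>\<^bsub>Q\<^esub> x \<otimes>\<^bsub>Q\<^esub> b) \<oplus>\<^bsub>Q\<^esub> \<nu> \<otimes>\<^bsub>Q\<^esub> y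
        = (a' \<otimes>\<^bsub>Q\<^esub> a \<oplus>\<^bsub>Q\<^esub> \<nu>) \<otimes>\<^bsub>Q\<^esub> y \<ominus>\<^bsub>Q\<^esub> (a' \<otimes>\<^bsub>Q\<^esub> b) \<otimes>\<^bsub>Q\<^esub> x"
      using a'(1) \<nu> c ab
      by (simp add: Q.minus_eq Q.l_distr Q.r_distr Q.m_ac Q.a_ac Q.r_minus)
    ultimately have "y \<ominus>\<^bsub>Q\<^esub> (a' \<otimes>\<^bsub>Q\<^esub> b) \<otimes>\<^bsub>Q\<^esub> x \<in> BI" using a'(3) c by simp
    then show False using xy(4)[of "a' \<otimes>\<^bsub>Q\<^esub> b"] a'(1) ab(2) by simp
  qed
  then show ?thesis using that xy by blast
qed

end

section \<open>Module homomorphisms and multiples by an ideal\<close>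

text \<open>Carries the basis of \<open>F\<^sub>0\<close> over to \<open>M\<close> when the augmentation is bijective.\<close>
lemma isomorphic_image_of_basis:
  assumes V: "module R V" and M: "module R M" and f: "f \<in> module_hom R V M"
    and bij: "bij_betw f (carrier V) (carrier M)" and S: "finite S" "module_basis R V S"
  shows "module_basis R M (f ` S)"
proof -
  interpret f: mod_hom R V M f using V M f by (simp add: mod_hom_def mod_hom_axioms_def)
  have S': "S \<subseteq> carrier V" "f.M.lin_indpt S" "f.M.span S = carrier V"
    using S(2) by (auto simp: module_basis_def)
  have inj: "inj_on f (carrier V)" and im: "f ` carrier V = carrier M"
    using bij by (auto simp: bij_betw_def)
  have fS: "f ` S \<subseteq> carrier M" using S'(1) im by blast
  have "f.N.lin_indpt (f ` S)"
  proof (rule f.N.finite_lin_indpt2[OF finite_imageI[OF S(1)] fS])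
    fix a assume a: "a \<in> f ` S \<rightarrow> carrier R" "f.N.lincomb a (f ` S) = \<zero>\<^bsub>M\<^esub>"
    have a': "(\<lambda>e. a (f e)) \<in> S \<rightarrow> carrier R" using a(1) by (auto simp: Pi_iff)
    have "f.N.lincomb a (f ` S) = (\<Oplus>\<^bsub>M\<^esub>e\<in>S. a (f e) \<odot>\<^bsub>M\<^esub> f e)"
      unfolding f.N.lincomb_def
      by (rule f.N.M.add.finprod_reindex) (use a fS inj S'(1) in \<open>auto intro: inj_on_subset\<close>)
    also have "\<dots> = (\<Oplus>\<^bsub>M\<^esub>e\<in>S. f (a (f e) \<odot>\<^bsub>V\<^esub> e))"
      by (rule f.N.M.finsum_cong') (use a' S'(1) f.f_im in \<open>auto simp: Pi_iff subsetD\<close>)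
    also have "\<dots> = f (f.M.lincomb (\<lambda>e. a (f e)) S)"
      unfolding f.M.lincomb_def
      by (rule f.hom_sum[symmetric]) (use S'(1) a' in \<open>auto simp: Pi_iff\<close>)
    finally have "f (f.M.lincomb (\<lambda>e. a (f e)) S) = f \<zero>\<^bsub>V\<^esub>" using a(2) f.f0_is_0 by simp
    then have "f.M.lincomb (\<lambda>e. a (f e)) S = \<zero>\<^bsub>V\<^esub>"
      by (rule inj_onD[OF inj _ f.M.lincomb_closed[OF S'(1) a'] f.M.M.zero_closed])
    then have "a (f e) = \<zero>\<^bsub>R\<^esub>" if "e \<in> S" for e
      using f.M.lin_dep_crit[OF S(1) subset_refl a' that] S'(2) by blast
    then show "\<forall>v\<in>f ` S. a v = \<zero>\<^bsub>R\<^esub>" by blast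
  qed
  moreover have "f.N.span (f ` S) = carrier M"
  proof
    show "f.N.span (f ` S) \<subseteq> carrier M" by (rule f.N.span_is_subset2[OF fS])
    have sub: "LinearCombinations.submodule R (f.N.span (f ` S)) M"
      by (rule f.N.span_is_submodule[OF fS])
    have "LinearCombinations.submodule R {v \<in> carrier V. f v \<in> f.N.span (f ` S)} V"
      by (rule submodule_intro[OF V])
        (use submodule.zero_closed[OF sub] submodule.m_closed[OF sub] submodule.smult_closed[OF sub]
          f.f0_is_0 in auto)
    moreover have "S \<subseteq> {v \<in> carrier V. f v \<in> f.N.span (f ` S)}"
      using S'(1) f.N.in_own_span[OF fS] by blast
    ultimately have "carrier V \<subseteq> {v \<in> carrier V. f v \<in> f.N.span (f ` S)}"
      using f.M.span_is_subset[of S] S'(3) by simp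
    then have "f ` carrier V \<subseteq> f.N.span (f ` S)" by auto
    then show "carrier M \<subseteq> f.N.span (f ` S)" unfolding im .
  qed
  ultimately show ?thesis unfolding module_basis_def using fS by blast
qed

lemma smult_annihilates_ideal_smult:
  assumes V: "module R V" and \<sigma>: "\<sigma> \<in> carrier R" and I: "I \<subseteq> carrier R"
    and ann: "\<And>a. a \<in> I \<Longrightarrow> \<sigma> \<otimes>\<^bsub>R\<^esub> a = \<zero>\<^bsub>R\<^esub>"
    and w: "w \<in> ideal_smult R I V"
  shows "\<sigma> \<odot>\<^bsub>V\<^esub> w = \<zero>\<^bsub>V\<^esub>"
proof -
  interpret V: module R V by (rule V)
  let ?A = "{v \<in> carrier V. \<sigma> \<odot>\<^bsub>V\<^esub> v = \<zero>\<^bsub>V\<^esub>}"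
  have "LinearCombinations.submodule R ?A V"
  proof (rule submodule_intro[OF V])
    show "c \<odot>\<^bsub>V\<^esub> v \<in> ?A" if "c \<in> carrier R" "v \<in> ?A" for c v
    proof -
      have v: "v \<in> carrier V" using that by simp
      have "\<sigma> \<odot>\<^bsub>V\<^esub> (c \<odot>\<^bsub>V\<^esub> v) = c \<odot>\<^bsub>V\<^esub> (\<sigma> \<odot>\<^bsub>V\<^esub> v)"
        using V.smult_assoc1[OF \<sigma> that(1) v] V.smult_assoc1[OF that(1) \<sigma> v] V.R.m_comm[OF \<sigma> that(1)]
        by simp
      then show ?thesis using that by simp
    qed
  qed (use \<sigma> in \<open>auto simp: V.smult_r_distr\<close>)
  moreover have "a \<odot>\<^bsub>V\<^esub> x \<in> ?A" if "a \<in> I" "x \<in> carrier V" for a x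
    using that I \<sigma> ann[OF that(1)] by (auto simp flip: V.smult_assoc1)
  ultimately have "ideal_smult R I V \<subseteq> ?A" by (rule ideal_smult_subset)
  then show ?thesis using w by auto
qed

lemma module_hom_ideal_smult:
  assumes V: "module R V" and W: "module R W" and d: "d \<in> module_hom R V W"
    and N: "LinearCombinations.submodule R N W" "d ` carrier V \<subseteq> N"
    and I: "I \<subseteq> carrier R" and v: "v \<in> ideal_smult R I V"
  shows "d v \<in> ideal_smult R I (W\<lparr>carrier := N\<rparr>)"
proof -
  interpret d: mod_hom R V W d using V W d by (simp add: mod_hom_def mod_hom_axioms_def)
  let ?N = "W\<lparr>carrier := N\<rparr>"
  have mN: "module R ?N" by (rule d.N.submodule_is_module[OF N(1)])
  have sub: "LinearCombinations.submodule R (ideal_smult R I ?N) ?N"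
    by (rule ideal_smult_submodule[OF mN I])
  have "LinearCombinations.submodule R {v \<in> carrier V. d v \<in> ideal_smult R I ?N} V"
    by (rule submodule_intro[OF V])
      (use submodule.zero_closed[OF sub] submodule.m_closed[OF sub] submodule.smult_closed[OF sub]
        d.f0_is_0 in auto)
  moreover have "a \<odot>\<^bsub>V\<^esub> x \<in> {v \<in> carrier V. d v \<in> ideal_smult R I ?N}"
    if "a \<in> I" "x \<in> carrier V" for a x
  proof -
    have "d x \<in> carrier ?N" using N(2) that by auto
    from ideal_smult_mem[OF mN I that(1) this] show ?thesis using that I by auto
  qed
  ultimately have "ideal_smult R I V \<subseteq> {v \<in> carrier V. d v \<in> ideal_smult R I ?N}"
    by (rule ideal_smult_subset)
  then show ?thesis using v by auto
qed

lemma (in module) lincomb_in_ideal_smult: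
  assumes "I \<subseteq> carrier R" "S \<subseteq> carrier M" "\<And>e. e \<in> S \<Longrightarrow> a e \<in> I"
  shows "lincomb a S \<in> ideal_smult R I M"
proof -
  have sub: "LinearCombinations.submodule R (ideal_smult R I M) M"
    by (rule ideal_smult_submodule[OF module_axioms assms(1)])
  have "(\<Oplus>\<^bsub>M\<^esub>e\<in>S. a e \<odot>\<^bsub>M\<^esub> e) \<in> ideal_smult R I M"
    using assms(2,3)
  proof (induct S rule: infinite_finite_induct)
    case (insert e A)
    have ae: "a e \<odot>\<^bsub>M\<^esub> e \<in> ideal_smult R I M"
      using insert.prems by (intro ideal_smult_mem[OF module_axioms assms(1)]) auto
    have "(\<lambda>e. a e \<odot>\<^bsub>M\<^esub> e) \<in> A \<rightarrow> carrier M" "a e \<odot>\<^bsub>M\<^esub> e \<in> carrier M"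
      using insert.prems assms(1) by auto
    then show ?case using insert ae submodule.m_closed[OF sub ae] by simp
  qed (use submodule.zero_closed[OF sub] in simp_all)
  then show ?thesis unfolding lincomb_def .
qed

section \<open>Socle elements in a minimal resolution\<close>

context local_surjection
begin

text \<open>For a map \<open>d\<close> into \<open>m W\<close> each coordinate of \<open>d\<close> is a linear form as required above, and its
  kernel contains that of \<open>d\<close>.\<close>
lemma lift_mult_in_In_hom:
  assumes V: "module R V" "finite S" "module_basis R V S" and W: "module R W"
    and d: "d \<in> module_hom R V W" "d ` carrier V \<subseteq> ideal_smult R m W"
    and c: "linear_form R W c"
    and t: "t \<in> n" and f: "f \<in> carrier V" and b: "b \<in> carrier Q" "\<phi> b = c (d f)"
    and mem: "\<phi> t \<odot>\<^bsub>V\<^esub> f \<in> ideal_smult R m (V\<lparr>carrier := a_kernel V W d\<rparr>)"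
  shows "t \<otimes>\<^bsub>Q\<^esub> b \<in> In"
proof -
  interpret d: mod_hom R V W d using V(1) W d(1) by (simp add: mod_hom_def mod_hom_axioms_def)
  have lf: "linear_form R V (\<lambda>v. c (d v))"
    using linear_formD[OF c] by (auto simp: linear_form_def)
  show ?thesis
  proof (rule lift_mult_in_In[OF V lf _ kernel_submodule[OF V(1) W d(1)] _ t f b mem])
    show "c (d v) \<in> m" if "v \<in> carrier V" for v
      using linear_form_ideal_smult[OF W m.is_ideal c] d(2) that by blast
    show "c (d u) = \<zero>\<^bsub>R\<^esub>" if "u \<in> a_kernel V W d" for u
      using that d.N.linear_form_zero[OF c] by (simp add: a_kernel_def')
  qed
qed

lemma phi_socle_annihilates_m:
  assumes "s \<in> carrier Q" "\<And>x. x \<in> n \<Longrightarrow> s \<otimes>\<^bsub>Q\<^esub> x \<in> I" "\<mu> \<in> m"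
  shows "\<phi> s \<otimes>\<^bsub>R\<^esub> \<mu> = \<zero>\<^bsub>R\<^esub>"
proof -
  obtain x where x: "x \<in> n" "\<phi> x = \<mu>" using lift_m assms(3) by blast
  then have "\<phi> (s \<otimes>\<^bsub>Q\<^esub> x) = \<zero>\<^bsub>R\<^esub>" using assms(2) kernel_iff by blast
  then show ?thesis using x assms(1) n.Icarr by simp
qed

text \<open>Makes lifted socle elements eligible as multipliers \<open>t \<in> n\<close>. If \<open>s'\<close> were outside \<open>n\<close>, it would be invertible modulo \<open>n\<close>. As \<open>s n \<subseteq> I\<close> and \<open>s' s \<in> I\<close>, this would
  give \<open>s \<in> I\<close>.\<close>
lemma socle_in_n:
  assumes s: "s \<in> n" "s \<notin> I" "\<And>x. x \<in> n \<Longrightarrow> s \<otimes>\<^bsub>Q\<^esub> x \<in> I"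
    and s': "s' \<in> carrier Q" "\<And>x. x \<in> n \<Longrightarrow> s' \<otimes>\<^bsub>Q\<^esub> x \<in> I"
  shows "s' \<in> n"
proof (rule ccontr)
  assume "s' \<notin> n"
  then obtain a \<nu> where a: "a \<in> carrier Q" "\<nu> \<in> n" "a \<otimes>\<^bsub>Q\<^esub> s' \<oplus>\<^bsub>Q\<^esub> \<nu> = \<one>\<^bsub>Q\<^esub>"
    using Q.maximalideal_inverse[OF n.is_maximalideal s'(1)] by metis
  interpret I: ideal I Q by (rule I_ideal)
  have c: "s \<in> carrier Q" "\<nu> \<in> carrier Q" using s(1) a(2) n.Icarr by auto
  have "s = (a \<otimes>\<^bsub>Q\<^esub> s' \<oplus>\<^bsub>Q\<^esub> \<nu>) \<otimes>\<^bsub>Q\<^esub> s" using a(3) c by simp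
  also have "\<dots> = a \<otimes>\<^bsub>Q\<^esub> (s' \<otimes>\<^bsub>Q\<^esub> s) \<oplus>\<^bsub>Q\<^esub> s \<otimes>\<^bsub>Q\<^esub> \<nu>"
    using a(1) c s'(1) by (simp add: Q.l_distr Q.m_assoc Q.m_comm[of \<nu> s])
  also have "\<dots> \<in> I" by (intro I.a_closed I.I_l_closed s'(2) s(1,3) a(1,2))
  finally show False using s(2) by simp
qed

text \<open>If \<open>F\<^sub>1 = 0\<close>, then the augmentation is an isomorphism and \<open>M\<close> is free. If \<open>e\<close> is a basis element of
  \<open>F\<^sub>i\<close> with \<open>i \<ge> 1\<close>, then a nonzero socle element of \<open>R\<close> kills the image of \<open>e\<close>, which lies in \<open>m F\<^sub>i\<^sub>-\<^sub>1\<close>;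
  so its product with \<open>e\<close> is a nonzero boundary, and \<open>F\<^sub>i\<^sub>+\<^sub>1 \<noteq> 0\<close>.\<close>
lemma resolution_nonzero:
  assumes res: "minimal_free_resolution R m M F \<delta> \<epsilon>" and M: "module R M"
    and not_free: "\<not> free_module R M"
    and s: "s \<in> carrier Q" "s \<notin> I" "\<And>x. x \<in> n \<Longrightarrow> s \<otimes>\<^bsub>Q\<^esub> x \<in> I"
  shows "carrier (F (Suc i)) \<noteq> {\<zero>\<^bsub>F (Suc i)\<^esub>}"
proof (induct i)
  have F: "module R (F i)" and FS: "\<exists>S. finite S \<and> module_basis R (F i) S" for i
    using res by (auto simp: minimal_free_resolution_def)
  have hom: "\<delta> (Suc i) \<in> module_hom R (F (Suc i)) (F i)" for i
    using res by (auto simp: minimal_free_resolution_def)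
  case 0
  show ?case
  proof
    assume z: "carrier (F (Suc 0)) = {\<zero>\<^bsub>F (Suc 0)\<^esub>}"
    have \<epsilon>: "\<epsilon> \<in> module_hom R (F 0) M" and onto: "\<epsilon> ` carrier (F 0) = carrier M"
      and ex: "\<delta> 1 ` carrier (F 1) = a_kernel (F 0) M \<epsilon>"
      using res by (auto simp: minimal_free_resolution_def)
    interpret \<epsilon>: mod_hom R "F 0" M \<epsilon> using F M \<epsilon> by (simp add: mod_hom_def mod_hom_axioms_def)
    interpret d: mod_hom R "F (Suc 0)" "F 0" "\<delta> (Suc 0)"
      using F hom by (simp add: mod_hom_def mod_hom_axioms_def)
    have ker: "a_kernel (F 0) M \<epsilon> = {\<zero>\<^bsub>F 0\<^esub>}" using ex z d.f0_is_0 by simp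
    have "inj_on \<epsilon> (carrier (F 0))"
    proof (rule inj_onI)
      fix u v assume uv: "u \<in> carrier (F 0)" "v \<in> carrier (F 0)" "\<epsilon> u = \<epsilon> v"
      then have "\<epsilon> (u \<ominus>\<^bsub>F 0\<^esub> v) = \<zero>\<^bsub>M\<^esub>" using \<epsilon>.f_im by (simp add: \<epsilon>.N.M.minus_eq \<epsilon>.N.M.r_neg)
      then have "u \<ominus>\<^bsub>F 0\<^esub> v = \<zero>\<^bsub>F 0\<^esub>" using ker uv unfolding a_kernel_def' by blast
      moreover have "u = (u \<ominus>\<^bsub>F 0\<^esub> v) \<oplus>\<^bsub>F 0\<^esub> v"
        using uv by (simp add: \<epsilon>.M.M.minus_eq \<epsilon>.M.M.a_assoc \<epsilon>.M.M.l_neg)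
      ultimately show "u = v" using uv by simp
    qed
    then have "bij_betw \<epsilon> (carrier (F 0)) (carrier M)" using onto by (simp add: bij_betw_def)
    then show False
      using isomorphic_image_of_basis[OF F M \<epsilon>] FS[of 0] not_free M unfolding free_module_def by blast
  qed
next
  have F: "module R (F i)" and FS: "\<exists>S. finite S \<and> module_basis R (F i) S" for i
    using res by (auto simp: minimal_free_resolution_def)
  have hom: "\<delta> (Suc i) \<in> module_hom R (F (Suc i)) (F i)"
    and min: "\<delta> (Suc i) ` carrier (F (Suc i)) \<subseteq> ideal_smult R m (F i)"
    and ex: "\<delta> (Suc (Suc i)) ` carrier (F (Suc (Suc i))) = a_kernel (F (Suc i)) (F i) (\<delta> (Suc i))" for i
    using res by (auto simp: minimal_free_resolution_def)
  case (Suc i)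
  show ?case
  proof
    assume z: "carrier (F (Suc (Suc i))) = {\<zero>\<^bsub>F (Suc (Suc i))\<^esub>}"
    interpret d: mod_hom R "F (Suc i)" "F i" "\<delta> (Suc i)"
      using F hom by (simp add: mod_hom_def mod_hom_axioms_def)
    interpret d': mod_hom R "F (Suc (Suc i))" "F (Suc i)" "\<delta> (Suc (Suc i))"
      using F hom by (simp add: mod_hom_def mod_hom_axioms_def)
    obtain S where S: "finite S" "module_basis R (F (Suc i)) S" using FS by blast
    have S': "S \<subseteq> carrier (F (Suc i))" "d.M.span S = carrier (F (Suc i))"
      using S(2) by (auto simp: module_basis_def)
    have "S \<noteq> {}"
    proof
      assume "S = {}"
      then have "carrier (F (Suc i)) \<subseteq> {\<zero>\<^bsub>F (Suc i)\<^esub>}"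
        using S'(2) by (auto simp: d.M.span_def d.M.lincomb_def)
      then show False using Suc by auto
    qed
    then obtain e where e: "e \<in> S" by blast
    have ec: "e \<in> carrier (F (Suc i))" using e S' by blast
    obtain c where c: "\<And>e. e \<in> S \<Longrightarrow> linear_form R (F (Suc i)) (c e)"
      and c1: "\<And>e. e \<in> S \<Longrightarrow> c e e = \<one>\<^bsub>R\<^esub>"
      using basis_coordinates[OF F S] by metis
    have "\<phi> s \<odot>\<^bsub>F i\<^esub> \<delta> (Suc i) e = \<zero>\<^bsub>F i\<^esub>"
    proof (rule smult_annihilates_ideal_smult[OF F _ m.a_subset])
      show "\<phi> s \<in> carrier R" using s(1) by simp
      show "\<phi> s \<otimes>\<^bsub>R\<^esub> a = \<zero>\<^bsub>R\<^esub>" if "a \<in> m" for a by (rule phi_socle_annihilates_m[OF s(1,3) that])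
      show "\<delta> (Suc i) e \<in> ideal_smult R m (F i)" using min[of i] ec by blast
    qed
    then have "\<phi> s \<odot>\<^bsub>F (Suc i)\<^esub> e \<in> a_kernel (F (Suc i)) (F i) (\<delta> (Suc i))"
      unfolding a_kernel_iff
      using d.f_smult[OF phi.hom_closed[OF s(1)] ec] d.M.smult_closed[OF phi.hom_closed[OF s(1)] ec]
      by metis
    then have "\<phi> s \<odot>\<^bsub>F (Suc i)\<^esub> e = \<zero>\<^bsub>F (Suc i)\<^esub>" using ex[of i] z d'.f0_is_0 by auto
    then have "c e (\<phi> s \<odot>\<^bsub>F (Suc i)\<^esub> e) = \<zero>\<^bsub>R\<^esub>" using d.M.linear_form_zero[OF c[OF e]] by simp
    then have "\<phi> s = \<zero>\<^bsub>R\<^esub>" using linear_formD(3)[OF c[OF e], of "\<phi> s" e] ec s(1) c1[OF e] by simp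
    then show False using s by (simp add: kernel_iff)
  qed
qed

text \<open>Writing \<open>p = r + 4\<close>, the proof climbs from \<open>F\<^sub>p\<^sub>-\<^sub>3\<close> to \<open>F\<^sub>p\<close> and ends with a socle element of the
  kernel \<open>N\<close> of the map out of \<open>F\<^sub>p\<close> that is not in \<open>m N\<close>. The comparison with \<open>I n\<close> is made twice,
  for the multiplier \<open>x\<^sub>1\<close> of \<open>y\<close> and for a lifted socle element as multiplier of \<open>f\<close>.\<close>
theorem k_rank_syzygy_ge_one:
  assumes res: "minimal_free_resolution R m M F \<delta> \<epsilon>" and M: "module R M"
    and not_free: "\<not> free_module R M" and burch: "burch_index Q n R \<phi> \<ge> 2"
  shows "k_rank R m (syz_Suc F \<delta> M \<epsilon> (Suc (Suc (Suc (Suc r))))) \<ge> 1"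
proof -
  have F: "module R (F i)" and FS: "\<exists>S. finite S \<and> module_basis R (F i) S" for i
    using res by (auto simp: minimal_free_resolution_def)
  have hom: "\<delta> (Suc i) \<in> module_hom R (F (Suc i)) (F i)"
    and min: "\<delta> (Suc i) ` carrier (F (Suc i)) \<subseteq> ideal_smult R m (F i)"
    and ex: "\<delta> (Suc (Suc i)) ` carrier (F (Suc (Suc i))) = a_kernel (F (Suc i)) (F i) (\<delta> (Suc i))" for i
    using res by (auto simp: minimal_free_resolution_def)
  have kill: "\<phi> s \<odot>\<^bsub>F i\<^esub> \<delta> (Suc i) v = \<zero>\<^bsub>F i\<^esub>"
    if "s \<in> carrier Q" "\<And>x. x \<in> n \<Longrightarrow> s \<otimes>\<^bsub>Q\<^esub> x \<in> I" "v \<in> carrier (F (Suc i))" for s i v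
  proof (rule smult_annihilates_ideal_smult[OF F _ m.a_subset])
    show "\<phi> s \<in> carrier R" using that(1) by simp
    show "\<phi> s \<otimes>\<^bsub>R\<^esub> a = \<zero>\<^bsub>R\<^esub>" if "a \<in> m" for a
      by (rule phi_socle_annihilates_m[OF \<open>s \<in> carrier Q\<close> _ that]) (rule \<open>\<And>x. x \<in> n \<Longrightarrow> s \<otimes>\<^bsub>Q\<^esub> x \<in> I\<close>)
    show "\<delta> (Suc i) v \<in> ideal_smult R m (F i)" using min[of i] that(3) by blast
  qed
  let ?V1 = "F (Suc r)" and ?V2 = "F (Suc (Suc r))" and ?V3 = "F (Suc (Suc (Suc r)))"
    and ?V4 = "F (Suc (Suc (Suc (Suc r))))"
  let ?d1 = "\<delta> (Suc r)" and ?d2 = "\<delta> (Suc (Suc r))" and ?d3 = "\<delta> (Suc (Suc (Suc r)))"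
    and ?d4 = "\<delta> (Suc (Suc (Suc (Suc r))))"
  interpret d1: mod_hom R ?V1 "F r" ?d1 using F hom by (simp add: mod_hom_def mod_hom_axioms_def)
  interpret d2: mod_hom R ?V2 ?V1 ?d2 using F hom by (simp add: mod_hom_def mod_hom_axioms_def)
  interpret d3: mod_hom R ?V3 ?V2 ?d3 using F hom by (simp add: mod_hom_def mod_hom_axioms_def)
  interpret d4: mod_hom R ?V4 ?V3 ?d4 using F hom by (simp add: mod_hom_def mod_hom_axioms_def)
  obtain x1 x2 where x: "x1 \<in> n" "x1 \<notin> BI" "x2 \<in> n"
    and indep: "\<And>a b. a \<in> carrier Q \<Longrightarrow> b \<in> carrier Q \<Longrightarrow> a \<notin> n \<Longrightarrow> x2 \<otimes>\<^bsub>Q\<^esub> a \<ominus>\<^bsub>Q\<^esub> x1 \<otimes>\<^bsub>Q\<^esub> b \<notin> BI"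
    using independent_pair[OF burch] by metis
  have xc: "x1 \<in> carrier Q" "x2 \<in> carrier Q" using x n.Icarr by auto
  obtain s where s: "s \<in> carrier Q" "\<And>x. x \<in> n \<Longrightarrow> s \<otimes>\<^bsub>Q\<^esub> x \<in> I" "s \<otimes>\<^bsub>Q\<^esub> x1 \<notin> In"
    using not_BI[OF xc(1) x(2)] by metis
  have sI: "s \<notin> I" using s(3) In_mem(1) x(1) by blast
  obtain S where S: "finite S" "module_basis R ?V1 S" using FS by blast
  have S': "S \<subseteq> carrier ?V1" "d1.M.span S = carrier ?V1" using S(2) by (auto simp: module_basis_def)
  have "S \<noteq> {}"
  proof
    assume "S = {}"
    then have "carrier ?V1 \<subseteq> {\<zero>\<^bsub>?V1\<^esub>}"
      using S'(2) by (auto simp: d1.M.span_def d1.M.lincomb_def)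
    then show False using resolution_nonzero[OF res M not_free s(1) sI s(2), of r] by auto
  qed
  then obtain e where e: "e \<in> S" by blast
  have ec: "e \<in> carrier ?V1" using e S' by blast
  obtain c where c: "linear_form R ?V1 c" and ce: "c e = \<one>\<^bsub>R\<^esub>"
    using basis_coordinates[OF F S] e by metis
  have cse: "c (\<phi> s \<odot>\<^bsub>?V1\<^esub> e) = \<phi> s" using linear_formD(3)[OF c, of "\<phi> s" e] ec s(1) ce by simp
  \<comment> \<open>A socle multiple of a basis element is a cycle, hence a boundary \<open>d y\<close>.\<close>
  have "\<phi> s \<odot>\<^bsub>?V1\<^esub> e \<in> a_kernel ?V1 (F r) ?d1"
    unfolding a_kernel_iff
    using d1.f_smult[OF phi.hom_closed[OF s(1)] ec] d1.M.smult_closed[OF phi.hom_closed[OF s(1)] ec]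
      kill[OF s(1,2) ec] by metis
  then obtain y where y: "y \<in> carrier ?V2" "?d2 y = \<phi> s \<odot>\<^bsub>?V1\<^esub> e"
    using ex[of r] by (metis imageE)
  have "?d2 y \<in> ideal_smult R m ?V1" using min y(1) by blast
  then have "\<phi> s \<in> m" using linear_form_ideal_smult[OF F m.is_ideal c] cse y(2) by metis
  then have sn: "s \<in> n" using phi_mem_m_iff s(1) by blast
  \<comment> \<open>Elements of \<open>n\<close> turn \<open>y\<close> into a cycle.\<close>
  have xy: "\<exists>v\<in>carrier ?V3. ?d3 v = \<phi> x \<odot>\<^bsub>?V2\<^esub> y" if "x \<in> n" for x
  proof -
    have xc: "x \<in> carrier Q" using that n.Icarr by blast
    have "?d2 (\<phi> x \<odot>\<^bsub>?V2\<^esub> y) = \<phi> x \<odot>\<^bsub>?V1\<^esub> (\<phi> s \<odot>\<^bsub>?V1\<^esub> e)" using y xc by simp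
    also have "\<dots> = (\<phi> s \<otimes>\<^bsub>R\<^esub> \<phi> x) \<odot>\<^bsub>?V1\<^esub> e"
      using xc s(1) ec by (simp add: R.m_comm flip: d1.M.smult_assoc1)
    also have "\<dots> = \<zero>\<^bsub>?V1\<^esub>"
      using phi_socle_annihilates_m[OF s(1,2), of "\<phi> x"] phi_mem_m_iff[OF xc] that ec by simp
    finally have "\<phi> x \<odot>\<^bsub>?V2\<^esub> y \<in> a_kernel ?V2 ?V1 ?d2"
      unfolding a_kernel_iff using d2.M.smult_closed[OF phi.hom_closed[OF xc] y(1)] by blast
    then show ?thesis using ex[of "Suc r"] by (metis imageE)
  qed
  obtain v1 where v1: "v1 \<in> carrier ?V3" "?d3 v1 = \<phi> x1 \<odot>\<^bsub>?V2\<^esub> y" using xy[OF x(1)] by blast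
  obtain v2 where v2: "v2 \<in> carrier ?V3" "?d3 v2 = \<phi> x2 \<odot>\<^bsub>?V2\<^esub> y" using xy[OF x(3)] by blast
  \<comment> \<open>The cycle \<open>x\<^sub>1 y\<close> is a minimal generator, because \<open>x\<^sub>1 s \<notin> I n\<close>.\<close>
  have v1m: "v1 \<notin> ideal_smult R m ?V3"
  proof
    assume "v1 \<in> ideal_smult R m ?V3"
    then have "?d3 v1 \<in> ideal_smult R m (?V2\<lparr>carrier := a_kernel ?V2 ?V1 ?d2\<rparr>)"
      using module_hom_ideal_smult[OF F F hom kernel_submodule[OF F F hom] _ m.a_subset] ex[of "Suc r"]
      by blast
    moreover obtain S2 where "finite S2" "module_basis R ?V2 S2" using FS by blast
    moreover have "\<phi> s = c (?d2 y)" using cse y(2) by simp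
    ultimately have "x1 \<otimes>\<^bsub>Q\<^esub> s \<in> In"
      using lift_mult_in_In_hom[OF F _ _ F hom min c x(1) y(1) s(1)] v1(2) by metis
    then show False using s(1,3) xc Q.m_comm by simp
  qed
  obtain S3 where S3: "finite S3" "module_basis R ?V3 S3" using FS by blast
  have S3c: "S3 \<subseteq> carrier ?V3" using S3(2) by (simp add: module_basis_def)
  obtain k where k: "\<And>e. e \<in> S3 \<Longrightarrow> linear_form R ?V3 (k e)"
    and kl: "\<And>v. v \<in> carrier ?V3 \<Longrightarrow> d3.M.lincomb (\<lambda>e. k e v) S3 = v"
    using basis_coordinates[OF F S3] by metis
  have "\<exists>e\<in>S3. k e v1 \<notin> m"
    using d3.M.lincomb_in_ideal_smult[OF m.a_subset S3c, of "\<lambda>e. k e v1"] kl[OF v1(1)] v1m by auto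
  then obtain e3 where e3: "e3 \<in> S3" "k e3 v1 \<notin> m" by blast
  define g where "g = k e3"
  have g: "linear_form R ?V3 g" unfolding g_def by (rule k[OF e3(1)])
  obtain a where a: "a \<in> carrier Q" "\<phi> a = g v1" using surj linear_formD(1)[OF g v1(1)] by blast
  obtain b where b: "b \<in> carrier Q" "\<phi> b = g v2" using surj linear_formD(1)[OF g v2(1)] by blast
  have an: "a \<notin> n" using phi_mem_m_iff[OF a(1)] a(2) e3(2) unfolding g_def by simp
  let ?\<beta> = "x2 \<otimes>\<^bsub>Q\<^esub> a \<ominus>\<^bsub>Q\<^esub> x1 \<otimes>\<^bsub>Q\<^esub> b"
  have \<beta>: "?\<beta> \<in> carrier Q" "?\<beta> \<notin> BI" using indep[OF a(1) b(1) an] xc a b by auto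
  \<comment> \<open>The relation between the cycles \<open>x\<^sub>1 y\<close> and \<open>x\<^sub>2 y\<close>; its coordinate \<open>g w\<close> lifts to an element
    outside the Burch ideal.\<close>
  define w where "w = \<phi> x2 \<odot>\<^bsub>?V3\<^esub> v1 \<oplus>\<^bsub>?V3\<^esub> (\<ominus>\<^bsub>R\<^esub> \<phi> x1) \<odot>\<^bsub>?V3\<^esub> v2"
  have gw: "\<phi> ?\<beta> = g w"
    unfolding w_def using linear_formD[OF g] xc a b v1 v2
    by (simp add: Q.minus_eq R.l_minus)
  have "?d3 w = \<phi> x2 \<odot>\<^bsub>?V2\<^esub> (\<phi> x1 \<odot>\<^bsub>?V2\<^esub> y) \<oplus>\<^bsub>?V2\<^esub> (\<ominus>\<^bsub>R\<^esub> \<phi> x1) \<odot>\<^bsub>?V2\<^esub> (\<phi> x2 \<odot>\<^bsub>?V2\<^esub> y)"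
    unfolding w_def using v1 v2 xc by simp
  also have "\<dots> = (\<phi> x2 \<otimes>\<^bsub>R\<^esub> \<phi> x1 \<oplus>\<^bsub>R\<^esub> (\<ominus>\<^bsub>R\<^esub> \<phi> x1) \<otimes>\<^bsub>R\<^esub> \<phi> x2) \<odot>\<^bsub>?V2\<^esub> y"
    using xc y(1) by (simp add: d2.M.smult_l_distr d2.M.smult_assoc1)
  also have "\<dots> = \<zero>\<^bsub>?V2\<^esub>" using xc y(1) by (simp add: R.l_minus R.m_comm[of "\<phi> x2"] R.r_neg)
  finally have w0: "?d3 w = \<zero>\<^bsub>?V2\<^esub>" .
  have "w \<in> carrier ?V3" unfolding w_def using v1(1) v2(1) xc by simp
  then have "w \<in> a_kernel ?V3 ?V2 ?d3" unfolding a_kernel_iff using w0 by blast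
  then obtain f where f: "f \<in> carrier ?V4" "?d4 f = w"
    using ex[of "Suc (Suc r)"] by (metis imageE)
  obtain s' where s': "s' \<in> carrier Q" "\<And>x. x \<in> n \<Longrightarrow> s' \<otimes>\<^bsub>Q\<^esub> x \<in> I" "s' \<otimes>\<^bsub>Q\<^esub> ?\<beta> \<notin> In"
    using not_BI[OF \<beta>] by metis
  have s'n: "s' \<in> n" by (rule socle_in_n[OF sn sI s(2) s'(1,2)])
  let ?K = "a_kernel ?V4 ?V3 ?d4"
  let ?N = "?V4\<lparr>carrier := ?K\<rparr>" and ?z = "\<phi> s' \<odot>\<^bsub>?V4\<^esub> f"
  have N: "module R ?N" by (rule d4.M.submodule_is_module[OF kernel_submodule[OF F F hom]])
  have zK: "?z \<in> ?K" 
    unfolding a_kernel_iff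
    using d4.f_smult[OF phi.hom_closed[OF s'(1)] f(1)] d4.M.smult_closed[OF phi.hom_closed[OF s'(1)] f(1)]
      kill[OF s'(1,2) f(1)] by metis
  have zm: "?z \<notin> ideal_smult R m ?N"
  proof
    assume "?z \<in> ideal_smult R m ?N"
    moreover obtain S4 where "finite S4" "module_basis R ?V4 S4" using FS by blast
    moreover have "\<phi> ?\<beta> = g (?d4 f)" using gw f(2) by simp
    ultimately have "s' \<otimes>\<^bsub>Q\<^esub> ?\<beta> \<in> In"
      using lift_mult_in_In_hom[OF F _ _ F hom min g s'n f(1) \<beta>(1)] by metis
    then show False using s'(3) by simp
  qed
  have "k_rank R m ?N \<ge> 1"
  proof (rule k_rank_ge_one[OF N m.is_maximalideal _ zm])
    show "\<mu> \<odot>\<^bsub>?N\<^esub> ?z = \<zero>\<^bsub>?N\<^esub>" if "\<mu> \<in> m" for \<mu>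
    proof -
      have "\<mu> \<odot>\<^bsub>?V4\<^esub> ?z = (\<phi> s' \<otimes>\<^bsub>R\<^esub> \<mu>) \<odot>\<^bsub>?V4\<^esub> f"
        using that m.Icarr f s'(1) by (simp add: R.m_comm flip: d4.M.smult_assoc1)
      then show ?thesis using phi_socle_annihilates_m[OF s'(1,2) that] f(1) by simp
    qed
  qed (use zK in simp)
  then show ?thesis by (simp add: syz_Suc_def)
qed

end

section \<open>The theorem in both settings\<close>

theorem theorem3p7:
  fixes Q :: "'q ring" and n :: "'q set" and R :: "'r ring" and m :: "'r set"
    and \<phi> :: "'q \<Rightarrow> 'r"
    and M :: "('r, 'm) module"
    and F :: "nat \<Rightarrow> ('r, 'f) module" and \<delta> :: "nat \<Rightarrow> 'f \<Rightarrow> 'f" and \<epsilon> :: "'f \<Rightarrow> 'm"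
    and QG :: "('l::finite \<Rightarrow> nat) \<Rightarrow> 'q set" and RG :: "('l \<Rightarrow> nat) \<Rightarrow> 'r set"
    and MG :: "('l \<Rightarrow> int) \<Rightarrow> 'm set" and FG :: "nat \<Rightarrow> ('l \<Rightarrow> int) \<Rightarrow> 'f set"
    and q :: nat
  assumes setting:
    "(local_ring Q n \<and> local_ring R m \<and> surjective_local_hom Q n R m \<phi> \<and>
      fin_gen_module R M \<and> minimal_free_resolution R m M F \<delta> \<epsilon>)
     \<or>
     (graded_local_ring Q QG n \<and> graded_local_ring R RG m \<and> surjective_local_hom Q n R m \<phi> \<and>
      (\<forall>d. \<phi> ` QG d \<subseteq> RG d) \<and>
      fin_gen_module R M \<and> graded_module R RG M MG \<and>
      minimal_graded_free_resolution R RG m M MG F FG \<delta> \<epsilon>)"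
    and not_free: "\<not> free_module R M"
    and burch: "burch_index Q n R \<phi> \<ge> 2"
    and q: "q \<ge> 4"
  shows "k_rank R m (syz_Suc F \<delta> M \<epsilon> q) \<ge> 1"
proof -
  have *: "cring Q \<and> cring R \<and> maximalideal n Q \<and> maximalideal m R"
    using setting graded_local_ring_maximalideal[of Q QG n] graded_local_ring_maximalideal[of R RG m]
    by (auto simp: local_ring_def graded_local_ring_def graded_ring_def)
  have hom: "surjective_local_hom Q n R m \<phi>" and M: "module R M"
    and res: "minimal_free_resolution R m M F \<delta> \<epsilon>"
    using setting by (auto simp: fin_gen_module_def minimal_graded_free_resolution_def)
  have "local_surjection Q n R m \<phi>"
    using * hom by (simp add: local_surjection_def local_surjection_axioms_def)
  moreover have "q = Suc (Suc (Suc (Suc (q - 4))))" using q by simp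
  ultimately show ?thesis
    using local_surjection.k_rank_syzygy_ge_one[OF _ res M not_free burch, of "q - 4"] by metis
qed

end
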